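(* Let $X$, $Y$, $Z$ be based cellular spaces with $X$ and $Y$ compact, and let $q\ge1$ be an integer. Let $b:Y\to Z$ be a based map that is strongly $(q-1)$-similar to the constant map $\ast^Y_Z:Y\to Z$ at the basepoint, i.e. $b\overset{q-1}{\approx}\ast^Y_Z$. Let $L$ be an abelian group and let $h:[X,Z]\to L$ be a function (a homotopy invariant). Then the invariant $$f:[X,Y]\to L,\qquad [a]\mapsto h([b\circ a]),$$ satisfies $$q\,\operatorname{ord} f\le\operatorname{ord} h.$$
   Context: **Spaces and maps.** A cellular space is a based CW-complex (basepoint a vertex). Maps are continuous and based unless called unbased; $\sim$ is based homotopy, and $[P,Q]$ is the set of based homotopy classes $[a]$ of based maps $a:P\to Q$. For based spaces $P,Q$, $Q^P$ is the set of based maps $P\to Q$, with the compact-open topology when regarded as a space (basepoint: the constant map $\ast^P_Q$ at the basepoint of $Q$). For a space $T$ and a space $W$, $W^{(T)}$ is the set of all unbased continuous maps $T\to W$. **Ensembles.** For a set $M$, $\langle M\rangle$ is the free abelian group with basis $\{\langle m\rangle: m\in M\}$; its elements are called ensembles. A function $M\to N$ induces a homomorphism $\langle M\rangle\to\langle N\rangle$ on basis elements. In particular, for $V\subseteq P$ the restriction homomorphism $A\mapsto A|_V$ sends $\langle a\rangle$ to $\langle a|_V\rangle$. **Filtration and order.** For an integer $s\ge 0$, $\langle Q^P\rangle^{(s)}$ is the subgroup of those $A\in\langle Q^P\rangle$ such that $A|_V=0$ in $\langle Q^{(V)}\rangle$ for every subset $V\subseteq P$ with $|V|\le s-1$. For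 $P$ compact, an abelian group $L$, a function $g:[P,Q]\to L$ and an integer $r\ge0$, we write $\operatorname{ord} g\le r$ if $\sum_i u_i\,g([a_i])=0$ for every ensemble $\sum_i u_i\langle a_i\rangle\in\langle Q^P\rangle^{(r+1)}$ (finite sum, $u_i\in\mathbb Z$, $a_i\in Q^P$). The order $\operatorname{ord} g$ is the least integer $r\ge0$ with this property, and $\operatorname{ord} g=\infty$ if there is none (with $q\cdot\infty=\infty$). **Simplices and fissile ensembles.** For a nonempty finite set $E$, $\Delta E$ is the simplex with vertex set $E$, i.e. the space of functions $t:E\to[0,1]$ with $\sum_{e}t_e=1$; for nonempty $F\subseteq E$, $\Delta F\subseteq\Delta E$ is the corresponding face. A layout in $E$ is a (possibly empty) set $\{F_i: i\in I\}$ of pairwise disjoint nonempty subsets of $E$; put $\Delta[F_*]=\bigcup_{i\in I}\Delta F_i\subseteq\Delta E$, a disjoint union of faces. For a space $W$, an ensemble $S\in\langle W^{(\Delta E)}\rangle$ is fissile if for every layout $\{F_i:i\in I\}$ in $E$ the ensemble $S|_{\Delta[F_*]}\in\langle W^{(\Delta[F_*])}\rangle$ is the image of $\bigotimes_{i\in I}S|_{\Delta F_i}$ under the homomorphism $\bigotimes_{i\in I}\langle W^{(\Delta F_i)}\rangle\to\langle W^{(\Delta[F_*])}\rangle$ that sends $\bigotimes_i\langle s_i\rangle$ to $\langle s\rangle$, where $s$ is the map with $s|_{\Delta F_i}=s_i$ for all $i$. (For the empty layout the condition says that the sum of the coefficients of $S$ equals $1$.) **Strong similarity.** Let $P$ be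 compact. $\langle (Q^P)^{(\Delta E)}\rangle^{(s)}_P$ is the subgroup of those ensembles $R=\sum_j w_j\langle s_j\rangle\in\langle (Q^P)^{(\Delta E)}\rangle$ such that, with $\hat s_j:\Delta E\times P\to Q$, $\hat s_j(t,x)=s_j(t)(x)$, one has $\sum_j w_j\langle\hat s_j|_V\rangle=0$ in $\langle Q^{(V)}\rangle$ for every $V\subseteq\Delta E\times P$ with $|V|\le s-1$. For $c\in Q^P$, let $Q^P_c\subseteq Q^P$ be the subspace of maps homotopic to $c$, and let $\Xi^{\Delta E}(c)\in(Q^P)^{(\Delta E)}$ be the constant map $\Delta E\to Q^P$ with value $c$. For $r\ge0$ and $c,c'\in Q^P$, $c$ is strongly $r$-similar to $c'$, written $c\overset{r}{\approx}c'$, if for every nonempty finite set $E$ there is a fissile ensemble $S\in\langle (Q^P_c)^{(\Delta E)}\rangle\subseteq\langle (Q^P)^{(\Delta E)}\rangle$ with $\langle\Xi^{\Delta E}(c')\rangle-S\in\langle (Q^P)^{(\Delta E)}\rangle^{(r+1)}_P$. *)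

theory Defs
  imports "HOL-Homology.Homology" "HOL-Library.Extended_Nat"
begin

section \<open>Based CW-complexes\<close>

text \<open>
  The closed unit ball, open unit ball and unit sphere in the Euclidean space of dimension
  \<open>n\<close>. For \<open>n = 0\<close> both balls are a single point and the sphere is empty.
\<close>

definition closed_disc :: "nat \<Rightarrow> (nat \<Rightarrow> real) set" where
  "closed_disc n = {x \<in> topspace (Euclidean_space n). (\<Sum>i<n. (x i)\<^sup>2) \<le> 1}"

definition open_disc :: "nat \<Rightarrow> (nat \<Rightarrow> real) set" where
  "open_disc n = {x \<in> topspace (Euclidean_space n). (\<Sum>i<n. (x i)\<^sup>2) < 1}"

definition bdry_sphere :: "nat \<Rightarrow> (nat \<Rightarrow> real) set" where
  "bdry_sphere n = {x \<in> topspace (Euclidean_space n). (\<Sum>i<n. (x i)\<^sup>2) = 1}"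

text \<open>\<open>C n\<close> is the set of open \<open>n\<close>-cells. The four clauses after the Hausdorff condition are:
  the cells partition the space; every cell has a characteristic map, whose boundary values
  lie in finitely many cells of lower dimension; the space has the weak topology with respect
  to the closed cells.\<close>

definition CW_structure :: "'a topology \<Rightarrow> (nat \<Rightarrow> 'a set set) \<Rightarrow> bool" where
  "CW_structure X C \<longleftrightarrow>
     Hausdorff_space X \<and>
     (\<Union>n. \<Union>(C n)) = topspace X \<and>
     (\<forall>m n. \<forall>d\<in>C m. \<forall>e\<in>C n. (m, d) \<noteq> (n, e) \<longrightarrow> d \<inter> e = {}) \<and>
     (\<forall>n. \<forall>e\<in>C n. \<exists>\<phi>.
        continuous_map (subtopology (Euclidean_space n) (closed_disc n)) X \<phi> \<and>
        homeomorphic_map (subtopology (Euclidean_space n) (open_disc n)) (subtopology X e) \<phi> \<and>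
        (\<exists>D. finite D \<and> D \<subseteq> (\<Union>m<n. C m) \<and> \<phi> ` bdry_sphere n \<subseteq> \<Union>D)) \<and>
     (\<forall>A\<subseteq>topspace X.
        (\<forall>n. \<forall>e\<in>C n. closedin X (A \<inter> (X closure_of e))) \<longrightarrow> closedin X A)"

definition cellular_space :: "'a topology \<Rightarrow> 'a \<Rightarrow> bool" where
  "cellular_space X x0 \<longleftrightarrow> (\<exists>C. CW_structure X C \<and> {x0} \<in> C 0)"


section \<open>Spaces of maps and homotopy classes\<close>

text \<open>Maps are represented by functions that are \<open>undefined\<close> outside the domain, so that
  equality of functions is equality of maps.\<close>

definition unbased_maps :: "'a topology \<Rightarrow> 'b topology \<Rightarrow> ('a \<Rightarrow> 'b) set" where
  "unbased_maps T W = {f \<in> extensional (topspace T). continuous_map T W f}"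

definition based_maps :: "'a topology \<Rightarrow> 'a \<Rightarrow> 'b topology \<Rightarrow> 'b \<Rightarrow> ('a \<Rightarrow> 'b) set" where
  "based_maps P p0 Q q0 = {f \<in> unbased_maps P Q. f p0 = q0}"

definition compact_open ::
    "'a topology \<Rightarrow> 'a \<Rightarrow> 'b topology \<Rightarrow> 'b \<Rightarrow> ('a \<Rightarrow> 'b) topology" where
  "compact_open P p0 Q q0 = topology_generated_by
     {{f \<in> based_maps P p0 Q q0. f ` K \<subseteq> U} | K U. compactin P K \<and> openin Q U}"

definition based_homotopic ::
    "'a topology \<Rightarrow> 'a \<Rightarrow> 'b topology \<Rightarrow> 'b \<Rightarrow> ('a \<Rightarrow> 'b) \<Rightarrow> ('a \<Rightarrow> 'b) \<Rightarrow> bool" where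
  "based_homotopic P p0 Q q0 = homotopic_with (\<lambda>k. k p0 = q0) P Q"

definition based_homotopy_rel ::
    "'a topology \<Rightarrow> 'a \<Rightarrow> 'b topology \<Rightarrow> 'b \<Rightarrow> ('a \<Rightarrow> 'b) rel" where
  "based_homotopy_rel P p0 Q q0 =
     {(f, g). f \<in> based_maps P p0 Q q0 \<and> g \<in> based_maps P p0 Q q0 \<and>
              based_homotopic P p0 Q q0 f g}"

definition homotopy_classes ::
    "'a topology \<Rightarrow> 'a \<Rightarrow> 'b topology \<Rightarrow> 'b \<Rightarrow> ('a \<Rightarrow> 'b) set set" where
  "homotopy_classes P p0 Q q0 = based_maps P p0 Q q0 // based_homotopy_rel P p0 Q q0"

definition homotopy_class ::
    "'a topology \<Rightarrow> 'a \<Rightarrow> 'b topology \<Rightarrow> 'b \<Rightarrow> ('a \<Rightarrow> 'b) \<Rightarrow> ('a \<Rightarrow> 'b) set" where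
  "homotopy_class P p0 Q q0 a = based_homotopy_rel P p0 Q q0 `` {a}"

definition map_component ::
    "'a topology \<Rightarrow> 'a \<Rightarrow> 'b topology \<Rightarrow> 'b \<Rightarrow> ('a \<Rightarrow> 'b) \<Rightarrow> ('a \<Rightarrow> 'b) topology" where
  "map_component P p0 Q q0 c =
     subtopology (compact_open P p0 Q q0)
       {f \<in> based_maps P p0 Q q0. based_homotopic P p0 Q q0 f c}"

definition const_map :: "'a topology \<Rightarrow> 'b \<Rightarrow> 'a \<Rightarrow> 'b" where
  "const_map T w = (\<lambda>t\<in>topspace T. w)"


section \<open>Ensembles, filtration and order\<close>

abbreviation ensembles :: "'m set \<Rightarrow> ('m \<Rightarrow>\<^sub>0 int) set" where
  "ensembles M \<equiv> carrier (free_Abelian_group M)"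

definition induced_hom :: "('m \<Rightarrow> 'n) \<Rightarrow> ('m \<Rightarrow>\<^sub>0 int) \<Rightarrow> ('n \<Rightarrow>\<^sub>0 int)" where
  "induced_hom \<phi> = frag_extend (\<lambda>m. frag_of (\<phi> m))"

definition restrict_ensemble ::
    "(('a \<Rightarrow> 'b) \<Rightarrow>\<^sub>0 int) \<Rightarrow> 'a set \<Rightarrow> (('a \<Rightarrow> 'b) \<Rightarrow>\<^sub>0 int)" where
  "restrict_ensemble A V = induced_hom (\<lambda>a. restrict a V) A"

text \<open>The condition \<open>card V < s\<close> stands for \<open>|V| \<le> s - 1\<close>; it is void for \<open>s = 0\<close>.\<close>

definition ensemble_filtration ::
    "'a topology \<Rightarrow> 'a \<Rightarrow> 'b topology \<Rightarrow> 'b \<Rightarrow> nat \<Rightarrow> (('a \<Rightarrow> 'b) \<Rightarrow>\<^sub>0 int) set" where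
  "ensemble_filtration P p0 Q q0 s =
     {A \<in> ensembles (based_maps P p0 Q q0).
        \<forall>V\<subseteq>topspace P. finite V \<and> card V < s \<longrightarrow> restrict_ensemble A V = 0}"

text \<open>The abelian group \<open>L\<close> is written multiplicatively, as is usual in HOL-Algebra: the
  sum of the \<open>u\<^sub>i g([a\<^sub>i])\<close> is a product of powers with integer exponents.\<close>

definition invariant_order_le ::
    "'a topology \<Rightarrow> 'a \<Rightarrow> 'b topology \<Rightarrow> 'b \<Rightarrow> ('l, 'm) monoid_scheme \<Rightarrow>
     (('a \<Rightarrow> 'b) set \<Rightarrow> 'l) \<Rightarrow> nat \<Rightarrow> bool" where
  "invariant_order_le P p0 Q q0 L g r \<longleftrightarrow>
     (\<forall>A \<in> ensemble_filtration P p0 Q q0 (r + 1).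
        finprod L (\<lambda>a. g (homotopy_class P p0 Q q0 a) [^]\<^bsub>L\<^esub> Poly_Mapping.lookup A a)
          (Poly_Mapping.keys A) = \<one>\<^bsub>L\<^esub>)"

definition invariant_order ::
    "'a topology \<Rightarrow> 'a \<Rightarrow> 'b topology \<Rightarrow> 'b \<Rightarrow> ('l, 'm) monoid_scheme \<Rightarrow>
     (('a \<Rightarrow> 'b) set \<Rightarrow> 'l) \<Rightarrow> enat" where
  "invariant_order P p0 Q q0 L g =
     (if \<exists>r. invariant_order_le P p0 Q q0 L g r
      then enat (LEAST r. invariant_order_le P p0 Q q0 L g r) else \<infinity>)"


section \<open>Simplices and fissile ensembles\<close>

text \<open>Vertex sets are finite sets of natural numbers. Points of the simplex on \<open>E\<close> vanish
  outside \<open>E\<close> (as for \<^const>\<open>standard_simplex\<close>), so that the simplex on a subset \<open>F\<close> of \<open>E\<close>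
  is literally a face of the simplex on \<open>E\<close>.\<close>

definition simplex_on :: "nat set \<Rightarrow> (nat \<Rightarrow> real) set" where
  "simplex_on E = {t. (\<forall>e. 0 \<le> t e \<and> t e \<le> 1) \<and> (\<forall>e. e \<notin> E \<longrightarrow> t e = 0) \<and> (\<Sum>e\<in>E. t e) = 1}"

definition simplex_space :: "nat set \<Rightarrow> (nat \<Rightarrow> real) topology" where
  "simplex_space E = subtopology (powertop_real UNIV) (simplex_on E)"

definition layout :: "nat set \<Rightarrow> nat set set \<Rightarrow> bool" where
  "layout E \<F> \<longleftrightarrow> (\<forall>F\<in>\<F>. F \<noteq> {} \<and> F \<subseteq> E) \<and> (\<forall>F\<in>\<F>. \<forall>G\<in>\<F>. F \<noteq> G \<longrightarrow> F \<inter> G = {})"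

definition layout_union :: "nat set set \<Rightarrow> (nat \<Rightarrow> real) set" where
  "layout_union \<F> = (\<Union>F\<in>\<F>. simplex_on F)"

definition glue_maps ::
    "nat set set \<Rightarrow> (nat set \<Rightarrow> (nat \<Rightarrow> real) \<Rightarrow> 'w) \<Rightarrow> (nat \<Rightarrow> real) \<Rightarrow> 'w" where
  "glue_maps \<F> \<sigma> = (\<lambda>t\<in>layout_union \<F>. \<sigma> (THE F. F \<in> \<F> \<and> t \<in> simplex_on F) t)"

text \<open>The image of the tensor product of the ensembles \<open>A F\<close>, for \<open>F\<close> in the layout,
  under the homomorphism that glues basis elements, expanded by multilinearity.\<close>

definition glue_tensor ::
    "nat set set \<Rightarrow> (nat set \<Rightarrow> (((nat \<Rightarrow> real) \<Rightarrow> 'w) \<Rightarrow>\<^sub>0 int)) \<Rightarrow>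
     (((nat \<Rightarrow> real) \<Rightarrow> 'w) \<Rightarrow>\<^sub>0 int)" where
  "glue_tensor \<F> A =
     (\<Sum>\<sigma> \<in> (\<Pi>\<^sub>E F\<in>\<F>. Poly_Mapping.keys (A F)).
        frag_cmul (\<Prod>F\<in>\<F>. Poly_Mapping.lookup (A F) (\<sigma> F)) (frag_of (glue_maps \<F> \<sigma>)))"

definition fissile ::
    "nat set \<Rightarrow> 'w topology \<Rightarrow> (((nat \<Rightarrow> real) \<Rightarrow> 'w) \<Rightarrow>\<^sub>0 int) \<Rightarrow> bool" where
  "fissile E W S \<longleftrightarrow>
     S \<in> ensembles (unbased_maps (simplex_space E) W) \<and>
     (\<forall>\<F>. layout E \<F> \<longrightarrow>
        restrict_ensemble S (layout_union \<F>) =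
        glue_tensor \<F> (\<lambda>F. restrict_ensemble S (simplex_on F)))"


section \<open>Strong similarity\<close>

definition simplex_filtration ::
    "'a topology \<Rightarrow> 'a \<Rightarrow> 'b topology \<Rightarrow> 'b \<Rightarrow> nat set \<Rightarrow> nat \<Rightarrow>
     (((nat \<Rightarrow> real) \<Rightarrow> 'a \<Rightarrow> 'b) \<Rightarrow>\<^sub>0 int) set" where
  "simplex_filtration P p0 Q q0 E s =
     {R \<in> ensembles (unbased_maps (simplex_space E) (compact_open P p0 Q q0)).
        \<forall>V \<subseteq> simplex_on E \<times> topspace P. finite V \<and> card V < s \<longrightarrow>
          induced_hom (\<lambda>\<sigma>. restrict (\<lambda>(t, x). \<sigma> t x) V) R = 0}"

definition strongly_similar ::
    "'a topology \<Rightarrow> 'a \<Rightarrow> 'b topology \<Rightarrow> 'b \<Rightarrow> nat \<Rightarrow> ('a \<Rightarrow> 'b) \<Rightarrow> ('a \<Rightarrow> 'b) \<Rightarrow> bool" where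
  "strongly_similar P p0 Q q0 r c c' \<longleftrightarrow>
     (\<forall>E. finite E \<and> E \<noteq> {} \<longrightarrow>
        (\<exists>S. fissile E (map_component P p0 Q q0 c) S \<and>
             frag_of (const_map (simplex_space E) c') - S
               \<in> simplex_filtration P p0 Q q0 E (r + 1)))"

end

theory Submission
  imports Defs "HOL-Analysis.Analysis"
begin

text \<open>
  Let \<open>A = \<Sum>u\<^sub>i\<langle>a\<^sub>i\<rangle>\<close> vanish on all sets of at most \<open>m\<close> points, where \<open>m\<close> is the integral part of
  \<open>ord h / q\<close>. It suffices to replace the maps \<open>b \<circ> a\<^sub>i\<close> by an ensemble of maps homotopic to them,
  with the same total coefficients, which vanishes on all sets of fewer than \<open>q(m + 1)\<close> points.

  First deform the \<open>a\<^sub>i\<close> to \<open>d\<^sub>i\<close> so that \<open>a\<^sub>i(x) = a\<^sub>j(x)\<close> implies \<open>d\<^sub>i = d\<^sub>j\<close> near \<open>x\<close>; this uses that nearby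
  points of a finite CW-complex can be pulled together. Then choose a sufficiently fine map \<open>\<phi>\<close> of \<open>X\<close>
  to a simplex on a vertex set \<open>E\<close>, take a fissile ensemble \<open>S = \<Sum>w\<^sub>j\<langle>s\<^sub>j\<rangle>\<close> for \<open>E\<close>, and form
  \<open>\<Sum>u\<^sub>i w\<^sub>j\<langle>x \<mapsto> s\<^sub>j(\<phi>(x))(d\<^sub>i(x))\<rangle>\<close>. A small set \<open>V \<subseteq> X\<close> falls into clusters, within which points are
  chained by common vertices of the carriers of their \<open>\<phi>\<close>-images; distinct clusters lie over disjoint
  faces and each of them lies near one point of \<open>X\<close>. As \<open>S\<close> is fissile, the restriction to \<open>V\<close> is a product
  over the clusters. A cluster of fewer than \<open>q\<close> points contributes the constant map, by strong
  similarity. There are at most \<open>m\<close> other clusters, and the contribution of each of them is determined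
  by the value of \<open>a\<^sub>i\<close> at one point. Hence the sum over \<open>i\<close> vanishes, because \<open>A\<close> does so on \<open>m\<close> points.
\<close>

section \<open>Pulling together nearby points of a finite CW-complex\<close>

text \<open>Replacing every map \<open>a\<close> of a family by \<open>x \<mapsto> G (p x, a x)\<close>, for a fixed member \<open>p\<close>, keeps all
  coincidences of values, since the same function of \<open>x\<close> and the value is applied to each map, and
  turns the coincidences of \<open>p\<close> with the other maps into local ones.\<close>

definition diagonal_equalizer :: "'b topology \<Rightarrow> 'b \<Rightarrow> ('b \<times> 'b \<Rightarrow> 'b) \<Rightarrow> bool" where
  "diagonal_equalizer Y y0 G \<longleftrightarrow>
     homotopic_with (\<lambda>k. k (y0, y0) = y0) (prod_topology Y Y) Y snd G \<and>
     (\<exists>U. openin (prod_topology Y Y) U \<and> (\<forall>p\<in>topspace Y. (p, p) \<in> U) \<and>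
        (\<forall>(p, z)\<in>U. G (p, z) = G (p, p)))"

lemma openin_continuous_map_vimage:
  assumes "continuous_map X Y f" "openin Y U"
  shows "openin X (topspace X \<inter> f -` U)"
  using assms by (simp add: continuous_map_def vimage_def Int_def)

text \<open>The pair \<open>(p, z)\<close> is first moved to
  \<open>w (p, z) = (p, A (p, z))\<close>; then, away from the core of the cell, both entries are
  collapsed into \<open>T\<close> by \<open>r\<close> at time 1 and the homotopy \<open>K\<close> to
  \<open>G'\<close> is applied. Near the diagonal either both points have \<open>\<rho>\<close>
  below 3/4, and \<open>A\<close> has already made the entries equal, or both entries lie in the
  collar, where \<open>G'\<close> does the equalizing.\<close>

lemma diagonal_equalizer_extend:
  fixes Y :: "'b topology"
  assumes T: "T \<subseteq> topspace Y" and y0: "y0 \<in> T"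
    and eqT: "diagonal_equalizer (subtopology Y T) y0 G'"
    and \<rho>: "continuous_map Y euclideanreal \<rho>"
    and r: "continuous_map (prod_topology (top_of_set {0..1::real}) Y) Y r"
    and r0: "\<And>y. y \<in> topspace Y \<Longrightarrow> r (0, y) = y"
    and ry0: "\<And>t. t \<in> {0..1} \<Longrightarrow> r (t, y0) = y0"
    and rT: "\<And>y. y \<in> topspace Y \<Longrightarrow> \<rho> y \<ge> 1/2 \<Longrightarrow> r (1, y) \<in> T"
    and A: "homotopic_with (\<lambda>k. k (y0, y0) = y0) (prod_topology Y Y) Y snd A"
    and App: "\<And>p. p \<in> topspace Y \<Longrightarrow> A (p, p) = p"
    and Apz: "\<And>p z. p \<in> topspace Y \<Longrightarrow> z \<in> topspace Y \<Longrightarrow> \<rho> p < 3/4 \<Longrightarrow> \<rho> z < 3/4 \<Longrightarrow> A (p, z) = p"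
  shows "\<exists>G. diagonal_equalizer Y y0 G"
proof -
  let ?YY = "prod_topology Y Y" and ?T = "subtopology Y T" and ?I = "top_of_set {0..1::real}"
  let ?P = "\<lambda>k::'b \<times> 'b \<Rightarrow> 'b. k (y0, y0) = y0"
  have y0Y: "y0 \<in> topspace Y" using T y0 by auto
  have TT: "topspace ?T = T" using T by auto
  obtain K where K: "continuous_map (prod_topology ?I (prod_topology ?T ?T)) ?T K"
    and K0: "\<And>x. K (0, x) = snd x" and K1: "\<And>x. K (1, x) = G' x"
    and Ky0: "\<And>t. t \<in> {0..1} \<Longrightarrow> K (t, (y0, y0)) = y0"
    using eqT unfolding diagonal_equalizer_def homotopic_with_def by blast
  obtain U' where U': "openin (prod_topology ?T ?T) U'" "\<And>p. p \<in> T \<Longrightarrow> (p, p) \<in> U'"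
      "\<And>p z. (p, z) \<in> U' \<Longrightarrow> G' (p, z) = G' (p, p)"
    using eqT unfolding diagonal_equalizer_def TT by blast
  have contA: "continuous_map ?YY Y A"
    using A homotopic_with_imp_continuous_maps by blast
  define w where "w = (\<lambda>x::'b \<times> 'b. (fst x, A x))"
  have contw: "continuous_map ?YY ?YY w"
    unfolding w_def by (intro continuous_map_pairedI contA continuous_map_fst)
  define r1 where "r1 = (\<lambda>y. r (1, y))"
  have contr1: "continuous_map Y Y r1"
    unfolding r1_def
    by (rule continuous_map_compose[OF _ r, unfolded o_def])
      (auto intro!: continuous_map_pairedI continuous_intros)
  define m where "m = (\<lambda>x::'b \<times> 'b. min (\<rho> (fst x)) (\<rho> (snd x)))"
  have contm: "continuous_map ?YY euclideanreal m"
    unfolding m_def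
    by (intro continuous_intros continuous_map_compose[OF _ \<rho>, unfolded o_def])
  \<comment> \<open>\<open>\<Lambda>\<close> is 0 where \<open>m\<close> is at most 1/2, so that the
    two formulas for \<open>H\<close> agree on the border, and 1 from 5/8 on, where the full
    \<open>G'\<close> is needed.\<close>
  define \<Lambda> where "\<Lambda> = (\<lambda>x. max 0 (min 1 (8 * m x - 4)))"
  have cont\<Lambda>: "continuous_map ?YY euclideanreal \<Lambda>"
    unfolding \<Lambda>_def by (intro continuous_intros contm) auto
  define rr where "rr = (\<lambda>x::'b \<times> 'b. (r1 (fst x), r1 (snd x)))"
  have contrr: "continuous_map ?YY ?YY rr"
    unfolding rr_def
    by (intro continuous_map_pairedI continuous_map_compose[OF _ contr1, unfolded o_def] continuous_intros)
  have contrr': "continuous_map (subtopology ?YY {x \<in> topspace ?YY. 1/2 \<le> m x}) (prod_topology ?T ?T) rr"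
  proof -
    have *: "prod_topology ?T ?T = subtopology ?YY (T \<times> T)"
      by (simp add: subtopology_Times)
    have "r1 y \<in> T" if "y \<in> topspace Y" "\<rho> y \<ge> 1/2" for y
      using rT[of y] that by (simp add: r1_def)
    then show ?thesis
      unfolding * continuous_map_in_subtopology
      by (auto simp: rr_def m_def intro!: continuous_map_from_subtopology[OF contrr, unfolded rr_def])
  qed
  define H where "H = (\<lambda>y::real \<times> 'b \<times> 'b. if 1/2 \<le> m (snd y) then K (fst y * \<Lambda> (snd y), rr (snd y)) else r1 (snd (snd y)))"
  have contH: "continuous_map (prod_topology ?I ?YY) Y H"
    unfolding H_def
  proof (rule continuous_map_cases_le)
    let ?S = "{x \<in> topspace (prod_topology ?I ?YY). 1/2 \<le> m (snd x)}"
    show "continuous_map (prod_topology ?I ?YY) euclideanreal (\<lambda>x. 1/2)" by simp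
    show "continuous_map (prod_topology ?I ?YY) euclideanreal (\<lambda>x. m (snd x))"
      by (intro continuous_map_compose[OF _ contm, unfolded o_def] continuous_intros)
    have cs: "continuous_map (subtopology (prod_topology ?I ?YY) ?S) ?YY snd"
      by (intro continuous_map_from_subtopology continuous_intros)
    show "continuous_map (subtopology (prod_topology ?I ?YY) ?S) Y (\<lambda>x. K (fst x * \<Lambda> (snd x), rr (snd x)))"
    proof (rule continuous_map_compose[where g=K, unfolded o_def])
      show "continuous_map (prod_topology ?I (prod_topology ?T ?T)) Y K"
        using K continuous_map_into_fulltopology by blast
      show "continuous_map (subtopology (prod_topology ?I ?YY) ?S) (prod_topology ?I (prod_topology ?T ?T))
              (\<lambda>x. (fst x * \<Lambda> (snd x), rr (snd x)))"
      proof (rule continuous_map_pairedI)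
        have "continuous_map (subtopology (prod_topology ?I ?YY) ?S) euclideanreal (\<lambda>x. fst x * \<Lambda> (snd x))"
          using continuous_map_compose[OF cs cont\<Lambda>, unfolded o_def]
          by (intro continuous_map_real_mult)
             (auto intro: continuous_map_into_fulltopology[OF continuous_map_fst] continuous_map_from_subtopology)
        moreover have "fst x * \<Lambda> (snd x) \<in> {0..1}" if "x \<in> topspace (subtopology (prod_topology ?I ?YY) ?S)" for x
          using that by (auto simp: \<Lambda>_def intro!: mult_nonneg_nonneg mult_le_one)
        ultimately show "continuous_map (subtopology (prod_topology ?I ?YY) ?S) ?I (\<lambda>x. fst x * \<Lambda> (snd x))"
          unfolding continuous_map_in_subtopology by blast
        show "continuous_map (subtopology (prod_topology ?I ?YY) ?S) (prod_topology ?T ?T) (\<lambda>x. rr (snd x))"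
        proof (rule continuous_map_compose[OF _ contrr', unfolded o_def])
          show "continuous_map (subtopology (prod_topology ?I ?YY) ?S) (subtopology ?YY {x \<in> topspace ?YY. 1/2 \<le> m x}) snd"
            unfolding continuous_map_in_subtopology using cs by auto
        qed
      qed
    qed
    show "continuous_map (subtopology (prod_topology ?I ?YY) {x \<in> topspace (prod_topology ?I ?YY). m (snd x) \<le> 1/2}) Y (\<lambda>x. r1 (snd (snd x)))"
      using continuous_map_compose[OF continuous_map_compose[OF continuous_map_snd continuous_map_snd] contr1]
      by (intro continuous_map_from_subtopology) (simp add: o_def)
    show "K (fst x * \<Lambda> (snd x), rr (snd x)) = r1 (snd (snd x))" if "1/2 = m (snd x)" for x
    proof -
      have "\<Lambda> (snd x) = 0" using that by (simp add: \<Lambda>_def)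
      then show ?thesis by (simp add: K0 rr_def)
    qed
  qed
  \<comment> \<open>The homotopy from \<open>snd\<close> to \<open>G\<close> has three stages: the
    given one to \<open>A\<close>, then \<open>r\<close> applied to \<open>A\<close>, then
    \<open>H\<close> applied to \<open>w\<close>.\<close>
  define G where "G = (\<lambda>x. H (1, w x))"
  have h2: "homotopic_with ?P ?YY Y A (\<lambda>x. r1 (A x))"
  proof (subst homotopic_with, goal_cases)
    case 2
    show ?case
    proof (intro exI conjI ballI)
      show "continuous_map (prod_topology ?I ?YY) Y (\<lambda>x. r (fst x, A (snd x)))"
        by (intro continuous_map_compose[OF _ r, unfolded o_def] continuous_map_pairedI
            continuous_map_compose[OF _ contA, unfolded o_def] continuous_intros)
    qed (use y0Y contA r0 ry0 Apz App in \<open>auto simp: r1_def continuous_map_def Pi_iff\<close>)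
  qed (use y0Y in simp)
  have wy0: "w (y0, y0) = (y0, y0)" using App y0Y by (simp add: w_def)
  have ry01: "r1 y0 = y0" using ry0[of 1] by (simp add: r1_def)
  have H0: "H (0, w x) = r1 (A x)" for x
    by (simp add: H_def K0 rr_def w_def)
  have Hy0: "H (t, (y0, y0)) = y0" if "t \<in> {0..1}" for t
    using that Ky0[of "t * \<Lambda> (y0, y0)"] ry01
    by (auto simp: H_def rr_def \<Lambda>_def intro!: Ky0 mult_nonneg_nonneg mult_le_one)
  have h3: "homotopic_with ?P ?YY Y (\<lambda>x. r1 (A x)) G"
  proof (subst homotopic_with, goal_cases)
    case 2
    show ?case
    proof (intro exI conjI ballI)
      show "continuous_map (prod_topology ?I ?YY) Y (\<lambda>x. H (fst x, w (snd x)))"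
        by (intro continuous_map_compose[OF _ contH, unfolded o_def] continuous_map_pairedI
            continuous_map_compose[OF _ contw, unfolded o_def] continuous_intros)
    qed (use H0 Hy0 wy0 in \<open>auto simp: G_def\<close>)
  qed (use y0Y in simp)
  have "homotopic_with ?P ?YY Y snd G"
    using A h2 h3 homotopic_with_trans by blast
  moreover
  \<comment> \<open>\<open>U1\<close> consists of pairs in the core, where
    \<open>w (p, z) = w (p, p)\<close>. On \<open>V2\<close> the factor \<open>\<Lambda>\<close> is
    1 and both entries of \<open>w\<close> collapse into \<open>T\<close>, so the neighbourhood
    \<open>U'\<close> can be pulled back to \<open>U2\<close>. As 5/8 < 3/4, the two together
    contain the diagonal.\<close>
  define U1 where "U1 = topspace ?YY \<inter> (\<lambda>x. max (\<rho> (fst x)) (\<rho> (snd x))) -` {..<3/4}"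
  define V2 where "V2 = topspace ?YY \<inter> (\<lambda>x. m (w x)) -` {5/8<..}"
  have oU1: "openin ?YY U1" unfolding U1_def
    by (rule openin_continuous_map_vimage[where Y=euclideanreal])
       (auto intro!: continuous_intros continuous_map_compose[OF _ \<rho>, unfolded o_def])
  have oV2: "openin ?YY V2" unfolding V2_def
    by (rule openin_continuous_map_vimage[where Y=euclideanreal])
       (auto intro!: continuous_map_compose[OF contw contm, unfolded o_def])
  have cV2: "continuous_map (subtopology ?YY V2) (prod_topology ?T ?T) (\<lambda>x. rr (w x))"
  proof (rule continuous_map_compose[OF _ contrr', unfolded o_def])
    show "continuous_map (subtopology ?YY V2) (subtopology ?YY {x \<in> topspace ?YY. 1/2 \<le> m x}) w"
      unfolding continuous_map_in_subtopology
      using continuous_map_image_subset_topspace[OF contw]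
      by (auto simp: V2_def simp del: topspace_prod_topology intro!: continuous_map_from_subtopology contw)
  qed
  define U2 where "U2 = V2 \<inter> (\<lambda>x. rr (w x)) -` U'"
  have "openin (subtopology ?YY V2) U2"
    using openin_continuous_map_vimage[OF cV2 U'(1)] openin_subset[OF oV2]
    by (simp add: U2_def Int_absorb1)
  then have oU2: "openin ?YY U2"
    using oV2 openin_trans_full by blast
  have "G (p, z) = G (p, p)" if "(p, z) \<in> U1" for p z
    using that Apz[of p z] App[of p] by (auto simp: U1_def G_def w_def)
  moreover have "G (p, z) = G (p, p)" if pz: "(p, z) \<in> U2" for p z
  proof -
    have p: "p \<in> topspace Y" using pz by (auto simp: U2_def V2_def)
    have mw: "m (w (p, z)) > 5/8" "\<rho> p > 5/8"
      using pz by (auto simp: U2_def V2_def m_def w_def)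
    have mw': "m (w (p, p)) > 5/8"
      using mw p by (simp add: m_def w_def App)
    have "G (p, z) = G' (rr (w (p, z)))"
      using mw(1) by (simp add: G_def H_def \<Lambda>_def K1)
    also have "\<dots> = G' (r1 p, r1 p)"
      using pz U'(3) by (auto simp: U2_def rr_def w_def)
    also have "\<dots> = G (p, p)"
      using mw' p by (simp add: G_def H_def \<Lambda>_def K1 rr_def w_def App)
    finally show ?thesis .
  qed
  moreover have "(p, p) \<in> U1 \<union> U2" if p: "p \<in> topspace Y" for p
  proof (cases "\<rho> p < 3/4")
    case True
    then show ?thesis using p by (simp add: U1_def)
  next
    case False
    then have "r1 p \<in> T" using rT p by (simp add: r1_def)
    then show ?thesis using False U'(2) p by (simp add: U2_def V2_def rr_def w_def App m_def)
  qed
  ultimately show ?thesis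
    using oU1 oU2 unfolding diagonal_equalizer_def by (intro exI[of _ G] conjI exI[of _ "U1 \<union> U2"]) auto
qed

text \<open>A continuous map from a compact to a Hausdorff space is closed, hence a quotient map
  onto its image; so continuity on a closed cell can be tested on the disc. The closed sets
  \<open>T\<close> and the image are then pasted.\<close>

lemma continuous_map_glue_closed_image:
  assumes T: "closedin Y T" and D: "compact_space D" and Y: "Hausdorff_space Y"
    and \<phi>: "continuous_map D Y \<phi>" and cover: "topspace Y \<subseteq> T \<union> \<phi> ` topspace D"
    and fT: "continuous_map (subtopology Y T) W f" and f\<phi>: "continuous_map D W (f \<circ> \<phi>)"
  shows "continuous_map Y W f"
proof -
  let ?C = "\<phi> ` topspace D"
  have C: "closedin Y ?C"
    using continuous_imp_closed_map[OF \<phi> D Y] by (simp add: closed_map_def)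
  have "quotient_map D (subtopology Y ?C) \<phi>"
    using \<phi> D Y closedin_subset[OF C]
    by (intro continuous_imp_quotient_map)
       (auto simp: continuous_map_in_subtopology Hausdorff_space_subtopology)
  then have fC: "continuous_map (subtopology Y ?C) W f"
    using f\<phi> continuous_compose_quotient_map by blast
  show ?thesis
    by (rule pasting_lemma_closed[of "{T, ?C}" Y "\<lambda>S. S" W "\<lambda>_. f"])
       (use T C fT fC cover in auto)
qed

section \<open>Squared norms, discs and the attaching of one cell\<close>

definition sqnorm :: "nat \<Rightarrow> (nat \<Rightarrow> real) \<Rightarrow> real" where
  "sqnorm n u = (\<Sum>i<n. (u i)\<^sup>2)"

lemma sqnorm_nonneg [simp]: "sqnorm n u \<ge> 0"
  by (simp add: sqnorm_def sum_nonneg)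

lemma sqnorm_scale: "sqnorm n (\<lambda>i. u i / c) = sqnorm n u / c\<^sup>2"
  by (simp add: sqnorm_def power_divide sum_divide_distrib)

lemma sqnorm_convex:
  assumes "0 \<le> s" "s \<le> 1"
  shows "sqnorm n (\<lambda>i. (1 - s) * v i + s * u i) \<le> max (sqnorm n u) (sqnorm n v)"
proof -
  have *: "((1 - s) * a + s * b)\<^sup>2 \<le> (1 - s) * a\<^sup>2 + s * b\<^sup>2" for a b :: real
  proof -
    have "(1 - s) * a\<^sup>2 + s * b\<^sup>2 - ((1 - s) * a + s * b)\<^sup>2 = s * (1 - s) * (a - b)\<^sup>2"
      by (simp add: power2_eq_square algebra_simps)
    moreover have "s * (1 - s) * (a - b)\<^sup>2 \<ge> 0" using assms by simp
    ultimately show ?thesis by linarith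
  qed
  have "sqnorm n (\<lambda>i. (1 - s) * v i + s * u i) \<le> (\<Sum>i<n. (1 - s) * (v i)\<^sup>2 + s * (u i)\<^sup>2)"
    unfolding sqnorm_def by (intro sum_mono *)
  also have "\<dots> = (1 - s) * sqnorm n v + s * sqnorm n u"
    by (simp add: sqnorm_def sum.distrib sum_distrib_left)
  also have "\<dots> \<le> max (sqnorm n u) (sqnorm n v)"
    by (rule convex_bound_le) (use assms in auto)
  finally show ?thesis .
qed

lemma subtopology_Euclidean_space:
  assumes "S \<subseteq> topspace (Euclidean_space n)"
  shows "subtopology (Euclidean_space n) S = subtopology (powertop_real UNIV) S"
  using assms by (simp add: Euclidean_space_def subtopology_subtopology Int_absorb1)

lemma continuous_map_sqnorm:
  assumes "continuous_map X (powertop_real UNIV) f"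
  shows "continuous_map X euclideanreal (\<lambda>x. sqnorm n (f x))"
  using assms unfolding sqnorm_def continuous_map_componentwise_UNIV
  by (intro continuous_intros) auto

lemma closed_disc_sub: "closed_disc n \<subseteq> topspace (Euclidean_space n)"
  and open_disc_sub: "open_disc n \<subseteq> topspace (Euclidean_space n)"
  by (auto simp: closed_disc_def open_disc_def)

text \<open>The disc lies in an infinite product of lines; there it is a closed subset of a product
  of intervals, which is compact by Tychonoff.\<close>

lemma compactin_closed_disc: "compactin (powertop_real UNIV) (closed_disc n)"
proof (rule closed_compactin)
  show "compactin (powertop_real UNIV) (PiE UNIV (\<lambda>i::nat. {-1..1::real}))"
    by (simp add: compactin_PiE)
  have "\<bar>x i\<bar> \<le> 1" if "x \<in> closed_disc n" for x i
  proof (cases "i < n")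
    case True
    have "(x i)\<^sup>2 \<le> (\<Sum>i<n. (x i)\<^sup>2)"
      by (rule member_le_sum) (use True in auto)
    also have "\<dots> \<le> 1" using that by (simp add: closed_disc_def)
    finally show ?thesis by (simp add: abs_square_le_1)
  qed (use that in \<open>auto simp: closed_disc_def topspace_Euclidean_space\<close>)
  then show "closed_disc n \<subseteq> PiE UNIV (\<lambda>i::nat. {-1..1::real})"
    by (fastforce simp: abs_le_iff)
  have "closedin (powertop_real UNIV)
          {x \<in> topspace (powertop_real UNIV). (\<lambda>x. sqnorm n x) x \<in> {..1}}"
    by (rule closedin_continuous_map_preimage[OF continuous_map_sqnorm]) auto
  moreover have "closed_disc n = topspace (Euclidean_space n) \<inter>
          {x \<in> topspace (powertop_real UNIV). (\<lambda>x. sqnorm n x) x \<in> {..1}}"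
    by (auto simp: closed_disc_def sqnorm_def)
  ultimately show "closedin (powertop_real UNIV) (closed_disc n)"
    using closedin_Euclidean_space by (metis closedin_Int)
qed

text \<open>The data required for the extension are written with the inverse \<open>\<psi>\<close>
  of the characteristic map on the open cell. Since \<open>\<psi>\<close> need not extend to the
  boundary, continuity of \<open>\<rho>\<close> and \<open>r\<close> is tested on the disc, while
  \<open>H\<close> uses \<open>\<psi>\<close> only at a distance from the boundary.\<close>

lemma diagonal_equalizer_attach_cell:
  fixes Y :: "'b topology"
  assumes cY: "compact_space Y" and hY: "Hausdorff_space Y"
    and T: "closedin Y T" and y0: "y0 \<in> T"
    and eqT: "diagonal_equalizer (subtopology Y T) y0 G'"
    and \<phi>: "continuous_map (subtopology (Euclidean_space n) (closed_disc n)) Y \<phi>"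
    and cell: "homeomorphic_map (subtopology (Euclidean_space n) (open_disc n))
                 (subtopology Y (topspace Y - T)) \<phi>"
    and bdry: "\<phi> ` bdry_sphere n \<subseteq> T"
  shows "\<exists>G. diagonal_equalizer Y y0 G"
proof -
  let ?R = "powertop_real (UNIV :: nat set)" and ?I = "top_of_set {0..1::real}"
  define D where "D = subtopology ?R (closed_disc n)"
  have cD: "compact_space D"
    unfolding D_def by (rule compact_space_subtopology[OF compactin_closed_disc])
  have tD: "topspace D = closed_disc n" by (simp add: D_def)
  have \<phi>: "continuous_map D Y \<phi>"
    using \<phi> by (simp add: D_def subtopology_Euclidean_space closed_disc_sub)
  obtain \<psi> where "homeomorphic_maps (subtopology ?R (open_disc n)) (subtopology Y (topspace Y - T)) \<phi> \<psi>"
    using cell by (auto simp: homeomorphic_map_maps subtopology_Euclidean_space open_disc_sub)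
  then have \<psi>: "continuous_map (subtopology Y (topspace Y - T)) (subtopology ?R (open_disc n)) \<psi>"
    and \<psi>\<phi>: "\<And>u. u \<in> open_disc n \<Longrightarrow> \<psi> (\<phi> u) = u"
    and \<phi>T: "\<And>u. u \<in> open_disc n \<Longrightarrow> \<phi> u \<in> topspace Y - T"
    and \<phi>\<psi>: "\<And>y. y \<in> topspace Y - T \<Longrightarrow> \<phi> (\<psi> y) = y"
    and \<psi>D: "\<And>y. y \<in> topspace Y - T \<Longrightarrow> \<psi> y \<in> open_disc n"
    by (auto simp: homeomorphic_maps_def continuous_map_def Pi_iff)
  have oc: "u \<in> open_disc n \<or> u \<in> bdry_sphere n" if "u \<in> closed_disc n" for u
    using that by (auto simp: open_disc_def bdry_sphere_def closed_disc_def)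
  have oc': "open_disc n \<subseteq> closed_disc n" "bdry_sphere n \<subseteq> closed_disc n"
    by (auto simp: open_disc_def bdry_sphere_def closed_disc_def)
  have \<nu>o: "sqnorm n u < 1" if "u \<in> open_disc n" for u using that by (simp add: open_disc_def sqnorm_def)
  have \<nu>c: "sqnorm n u \<le> 1" if "u \<in> closed_disc n" for u using that by (simp add: closed_disc_def sqnorm_def)
  have \<nu>b: "sqnorm n u = 1" if "u \<in> bdry_sphere n" for u using that by (simp add: bdry_sphere_def sqnorm_def)
  have TY: "T \<subseteq> topspace Y" using closedin_subset[OF T] .
  have cover: "topspace Y \<subseteq> T \<union> \<phi> ` topspace D"
  proof
    fix y assume "y \<in> topspace Y"
    then show "y \<in> T \<union> \<phi> ` topspace D"
      using \<phi>\<psi>[of y] \<psi>D[of y] oc'(1) tD by (cases "y \<in> T") (auto intro!: image_eqI[of y \<phi> "\<psi> y"])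
  qed
  have intoD: "continuous_map W D f"
    if "continuous_map W ?R f" "\<And>x. x \<in> topspace W \<Longrightarrow> f x \<in> closed_disc n" for W :: "'w topology" and f
    unfolding D_def using that by (auto intro!: continuous_map_into_subtopology)
  have idD: "continuous_map D ?R (\<lambda>u. u)" by (simp add: D_def continuous_map_from_subtopology)
  \<comment> \<open>\<open>\<rho>\<close> is the squared radius in the cell, \<open>r\<close> stretches the cell radially onto \<open>T\<close>, and \<open>H\<close> moves the
    second of two points in the core of the cell along a segment to the first one.\<close>
  define \<rho> where "\<rho> = (\<lambda>y. if y \<in> T then 1 else sqnorm n (\<psi> y))"
  have \<rho>\<phi>: "\<rho> (\<phi> u) = sqnorm n u" if "u \<in> closed_disc n" for u
    using oc[OF that] \<phi>T \<psi>\<phi> bdry \<nu>b by (auto simp: \<rho>_def)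
  have c\<rho>: "continuous_map Y euclideanreal \<rho>"
  proof (rule continuous_map_glue_closed_image[OF T cD hY \<phi> cover])
    show "continuous_map (subtopology Y T) euclideanreal \<rho>"
      by (rule continuous_map_eq[of _ _ "\<lambda>_. 1"]) (auto simp: \<rho>_def)
    show "continuous_map D euclideanreal (\<rho> \<circ> \<phi>)"
      by (rule continuous_map_eq[OF continuous_map_sqnorm[OF idD, of n]]) (simp add: \<rho>\<phi> tD)
  qed
  \<comment> \<open>The radius is enlarged by the factor \<open>1 + t\<close>, but not beyond 1:
    dividing by the norm once it exceeds \<open>1 / (1 + t)\<close> puts the point on the sphere.
    Thus time 0 is the identity, and time 1 sends all points of norm at least 1/2 to the
    boundary.\<close>
  define \<sigma> where "\<sigma> = (\<lambda>(t::real, u). \<lambda>i::nat. u i / max (1 / (1 + t)) (sqrt (sqnorm n u)))"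
  have \<sigma>pos: "max (1 / (1 + t)) (sqrt (sqnorm n u)) > 0" if "t \<in> {0..1}" for t u
    using that by (simp add: less_max_iff_disj)
  have \<sigma>D: "\<sigma> (t, u) \<in> closed_disc n" if "t \<in> {0..1}" "u \<in> closed_disc n" for t u
  proof -
    let ?c = "max (1 / (1 + t)) (sqrt (sqnorm n u))"
    have "sqnorm n u = (sqrt (sqnorm n u))\<^sup>2" by simp
    also have "\<dots> \<le> ?c\<^sup>2" by (rule power_mono) auto
    finally have "sqnorm n (\<sigma> (t, u)) \<le> 1"
      using \<sigma>pos[OF that(1), of u] by (simp add: \<sigma>_def sqnorm_scale divide_le_eq_1)
    moreover have "\<sigma> (t, u) \<in> topspace (Euclidean_space n)"
      using that by (auto simp: \<sigma>_def closed_disc_def topspace_Euclidean_space)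
    ultimately show ?thesis by (simp add: closed_disc_def sqnorm_def)
  qed
  have \<sigma>b: "\<sigma> (t, u) = u" if "t \<in> {0..1}" "u \<in> bdry_sphere n" for t u
    using that \<nu>b[OF that(2)] by (auto simp: \<sigma>_def max_def)
  have \<sigma>0: "\<sigma> (0, u) = u" if "u \<in> closed_disc n" for u
    using \<nu>c[OF that] by (auto simp: \<sigma>_def max_def)
  have \<sigma>1: "\<sigma> (1, u) \<in> bdry_sphere n" if "u \<in> closed_disc n" "sqnorm n u \<ge> 1/2" for u
  proof -
    have "sqrt (sqnorm n u) \<ge> 1/2"
      by (rule real_le_rsqrt) (use that in \<open>simp add: power2_eq_square\<close>)
    then have "max (1 / (1 + 1)) (sqrt (sqnorm n u)) = sqrt (sqnorm n u)" by simp
    then have "sqnorm n (\<sigma> (1, u)) = 1"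
      using that by (simp add: \<sigma>_def sqnorm_scale)
    then show ?thesis using \<sigma>D[of 1 u] that by (simp add: bdry_sphere_def closed_disc_def sqnorm_def)
  qed
  have c\<sigma>: "continuous_map (prod_topology ?I D) D \<sigma>"
  proof -
    have cs: "continuous_map (prod_topology ?I D) ?R snd"
      using continuous_map_compose[OF continuous_map_snd idD] by (simp add: o_def)
    have cf: "continuous_map (prod_topology ?I D) euclideanreal fst"
      by (rule continuous_map_into_fulltopology[OF continuous_map_fst])
    have "continuous_map (prod_topology ?I D) ?R (\<lambda>x. \<sigma> (fst x, snd x))"
      unfolding \<sigma>_def continuous_map_componentwise_UNIV split_beta fst_conv snd_conv
    proof (intro allI continuous_map_real_divide continuous_map_real_max continuous_map_sqrt
        continuous_map_sqnorm[OF cs] continuous_map_add cf)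
      show "continuous_map (prod_topology ?I D) euclideanreal (\<lambda>x. snd x k)" for k
        using cs by (simp add: continuous_map_componentwise_UNIV)
      show "max (1 / (1 + fst x)) (sqrt (sqnorm n (snd x))) \<noteq> 0"
        if "x \<in> topspace (prod_topology ?I D)" for x
        using \<sigma>pos[of "fst x" "snd x"] that by (metis less_irrefl mem_Times_iff topspace_euclidean_subtopology topspace_prod_topology)
      show "1 + fst x \<noteq> 0" if "x \<in> topspace (prod_topology ?I D)" for x
        using that by auto
    qed auto
    then show ?thesis
      using \<sigma>D by (intro intoD) (auto simp: tD)
  qed
  define r where "r = (\<lambda>(t::real, y). if y \<in> T then y else \<phi> (\<sigma> (t, \<psi> y)))"
  have r\<phi>: "r (t, \<phi> u) = \<phi> (\<sigma> (t, u))" if "t \<in> {0..1}" "u \<in> closed_disc n" for t u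
    using oc[OF that(2)] \<phi>T \<psi>\<phi> bdry \<sigma>b that by (auto simp: r_def)
  have cr: "continuous_map (prod_topology ?I Y) Y r"
  proof (rule continuous_map_glue_closed_image)
    let ?\<phi> = "\<lambda>x. (fst x, \<phi> (snd x))"
    show "closedin (prod_topology ?I Y) ({0..1} \<times> T)"
      using T closedin_topspace[of ?I] by (simp add: closedin_prod_Times_iff)
    show "compact_space (prod_topology ?I D)"
      using cD by (simp add: compact_space_prod_topology compact_space_subtopology)
    show "Hausdorff_space (prod_topology ?I Y)"
      using hY by (simp add: Hausdorff_space_prod_topology Hausdorff_space_subtopology)
    show "continuous_map (prod_topology ?I D) (prod_topology ?I Y) ?\<phi>"
      by (intro continuous_map_pairedI continuous_map_fst continuous_map_compose[OF continuous_map_snd \<phi>, unfolded o_def])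
    show "topspace (prod_topology ?I Y) \<subseteq> {0..1} \<times> T \<union> ?\<phi> ` topspace (prod_topology ?I D)"
      using cover by (force simp: image_iff)
    have "continuous_map (subtopology (prod_topology ?I Y) ({0..1} \<times> T)) Y snd"
      by (intro continuous_map_from_subtopology continuous_map_snd)
    then show "continuous_map (subtopology (prod_topology ?I Y) ({0..1} \<times> T)) Y r"
      by (rule continuous_map_eq) (auto simp: r_def)
    show "continuous_map (prod_topology ?I D) Y (r \<circ> ?\<phi>)"
      by (rule continuous_map_eq[OF continuous_map_compose[OF c\<sigma> \<phi>]]) (auto simp: r\<phi> tD)
  qed
  define M where "M = (\<lambda>x. max (\<rho> (fst x)) (\<rho> (snd x)))"
  \<comment> \<open>The cutoff is 1 for \<open>M\<close> up to 3/4, where the segment is to be run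
    to its end, and 0 at 7/8, where \<open>H\<close> must agree with the projection
    \<open>snd\<close> used outside the core.\<close>
  define \<mu> where "\<mu> = (\<lambda>x. max 0 (min 1 (7 - 8 * M x)))"
  define seg where "seg = (\<lambda>s (x::'b \<times> 'b) i. (1 - s) * \<psi> (snd x) i + s * \<psi> (fst x) i)"
  define H where "H = (\<lambda>y. if M (snd y) \<le> 7/8 then \<phi> (seg (fst y * \<mu> (snd y)) (snd y)) else snd (snd y))"
  let ?YY = "prod_topology Y Y"
  have cM: "continuous_map ?YY euclideanreal M"
    unfolding M_def
    by (intro continuous_intros continuous_map_compose[OF _ c\<rho>, unfolded o_def])
  have c\<mu>: "continuous_map ?YY euclideanreal \<mu>"
    unfolding \<mu>_def by (intro continuous_intros cM) auto
  have \<mu>01: "t * \<mu> x \<in> {0..1}" if "t \<in> {0..1}" for t x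
    using that by (auto simp: \<mu>_def intro!: mult_nonneg_nonneg mult_le_one)
  have notT: "y \<in> topspace Y - T" if "\<rho> y < 1" "y \<in> topspace Y" for y
    using that by (auto simp: \<rho>_def)
  have segD: "seg s x \<in> closed_disc n" if "s \<in> {0..1}" "x \<in> topspace ?YY" "M x \<le> 7/8" for s x
  proof -
    have *: "\<psi> (fst x) \<in> open_disc n" "\<psi> (snd x) \<in> open_disc n"
      using that by (auto simp: M_def intro!: \<psi>D notT)
    then have "sqnorm n (seg s x) \<le> 1"
      using sqnorm_convex[of s n "\<psi> (snd x)" "\<psi> (fst x)"] \<nu>o[OF *(1)] \<nu>o[OF *(2)] that(1)
      by (simp add: seg_def)
    moreover have "seg s x \<in> topspace (Euclidean_space n)"
      using * by (auto simp: open_disc_def topspace_Euclidean_space seg_def)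
    ultimately show ?thesis by (simp add: closed_disc_def sqnorm_def)
  qed
  have cH: "continuous_map (prod_topology ?I ?YY) Y H"
    unfolding H_def
  proof (rule continuous_map_cases_le)
    let ?S = "{x \<in> topspace (prod_topology ?I ?YY). M (snd x) \<le> 7/8}"
    let ?X = "subtopology (prod_topology ?I ?YY) ?S"
    show "continuous_map (prod_topology ?I ?YY) euclideanreal (\<lambda>x. M (snd x))"
      by (intro continuous_map_compose[OF _ cM, unfolded o_def] continuous_intros)
    show "continuous_map (prod_topology ?I ?YY) euclideanreal (\<lambda>x. 7/8)" by simp
    have cs: "continuous_map ?X ?YY snd"
      by (intro continuous_map_from_subtopology continuous_intros)
    have c1: "continuous_map ?X ?R (\<lambda>x. \<psi> (fst (snd x)))" "continuous_map ?X ?R (\<lambda>x. \<psi> (snd (snd x)))"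
    proof -
      have \<psi>': "continuous_map (subtopology Y (topspace Y - T)) ?R \<psi>"
        using \<psi> continuous_map_into_fulltopology by blast
      have "continuous_map ?X (subtopology Y (topspace Y - T)) (\<lambda>x. fst (snd x))"
        using continuous_map_compose[OF cs continuous_map_fst] notT
        by (auto simp: o_def M_def intro!: continuous_map_into_subtopology)
      then show "continuous_map ?X ?R (\<lambda>x. \<psi> (fst (snd x)))"
        using continuous_map_compose[OF _ \<psi>'] by (fastforce simp: o_def)
      have "continuous_map ?X (subtopology Y (topspace Y - T)) (\<lambda>x. snd (snd x))"
        using continuous_map_compose[OF cs continuous_map_snd] notT
        by (auto simp: o_def M_def intro!: continuous_map_into_subtopology)
      then show "continuous_map ?X ?R (\<lambda>x. \<psi> (snd (snd x)))"
        using continuous_map_compose[OF _ \<psi>'] by (fastforce simp: o_def)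
    qed
    have cf: "continuous_map ?X euclideanreal fst"
      by (intro continuous_map_from_subtopology continuous_map_into_fulltopology[OF continuous_map_fst])
    have c\<mu>s: "continuous_map ?X euclideanreal (\<lambda>x. \<mu> (snd x))"
      using continuous_map_compose[OF cs c\<mu>] by (simp add: o_def)
    have "continuous_map ?X ?R (\<lambda>x. seg (fst x * \<mu> (snd x)) (snd x))"
      using c1 cf c\<mu>s unfolding seg_def continuous_map_componentwise_UNIV
      by (auto intro!: continuous_intros)
    then have "continuous_map ?X D (\<lambda>x. seg (fst x * \<mu> (snd x)) (snd x))"
      using segD \<mu>01 by (intro intoD) auto
    then show "continuous_map ?X Y (\<lambda>x. \<phi> (seg (fst x * \<mu> (snd x)) (snd x)))"
      using continuous_map_compose[OF _ \<phi>] by (fastforce simp: o_def)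
    show "continuous_map (subtopology (prod_topology ?I ?YY) {x \<in> topspace (prod_topology ?I ?YY). 7/8 \<le> M (snd x)}) Y (\<lambda>x. snd (snd x))"
      using continuous_map_compose[OF continuous_map_snd continuous_map_snd]
      by (intro continuous_map_from_subtopology) (simp add: o_def)
    show "\<phi> (seg (fst x * \<mu> (snd x)) (snd x)) = snd (snd x)"
      if "x \<in> topspace (prod_topology ?I ?YY)" "M (snd x) = 7/8" for x
      using that notT by (auto simp: \<mu>_def seg_def M_def intro!: \<phi>\<psi>)
  qed
  show ?thesis
  proof (rule diagonal_equalizer_extend[OF TY y0 eqT c\<rho> cr, where A = "\<lambda>x. H (1, x)"])
    show "r (0, y) = y" if "y \<in> topspace Y" for y
      using that \<phi>\<psi>[of y] \<sigma>0[of "\<psi> y"] \<psi>D[of y] oc'(1) by (auto simp: r_def)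
    show "r (t, y0) = y0" for t using y0 by (simp add: r_def)
    show "r (1, y) \<in> T" if "y \<in> topspace Y" "\<rho> y \<ge> 1/2" for y
    proof (cases "y \<in> T")
      case False
      then have "\<psi> y \<in> closed_disc n" "sqnorm n (\<psi> y) \<ge> 1/2"
        using that \<psi>D oc'(1) by (auto simp: \<rho>_def)
      from \<sigma>1[OF this] show ?thesis using False bdry by (auto simp: r_def)
    qed (simp add: r_def)
    show "homotopic_with (\<lambda>k. k (y0, y0) = y0) ?YY Y snd (\<lambda>x. H (1, x))"
    proof (subst homotopic_with, goal_cases)
      case 2
      show ?case
      proof (intro exI conjI ballI)
        show "continuous_map (prod_topology ?I ?YY) Y H" by (rule cH)
        show "H (0, x) = snd x" if "x \<in> topspace ?YY" for x
          using that notT \<phi>\<psi> by (auto simp: H_def seg_def M_def)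
        show "H (t, (y0, y0)) = y0" for t using y0 by (simp add: H_def M_def \<rho>_def)
      qed auto
    qed (use y0 TY in auto)
    show "H (1, (p, p)) = p" if "p \<in> topspace Y" for p
    proof (cases "\<rho> p \<le> 7/8")
      case True
      have "seg s (p, p) = \<psi> p" for s by (auto simp: seg_def algebra_simps)
      then show ?thesis using True notT[of p] that by (simp add: H_def M_def \<phi>\<psi>)
    qed (simp add: H_def M_def)
    show "H (1, (p, z)) = p" if "p \<in> topspace Y" "z \<in> topspace Y" "\<rho> p < 3/4" "\<rho> z < 3/4" for p z
    proof -
      have "\<mu> (p, z) = 1" "M (p, z) \<le> 7/8" using that by (auto simp: \<mu>_def M_def)
      then show ?thesis using notT[of p] that by (simp add: H_def seg_def \<phi>\<psi>)
    qed
  qed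
qed

section \<open>Cells of a compact CW-complex and induction over them\<close>

lemmas CW_structureD =
  CW_structure_def[THEN iffD1, THEN conjunct1]
  CW_structure_def[THEN iffD1, THEN conjunct2, THEN conjunct1]
  CW_structure_def[THEN iffD1, THEN conjunct2, THEN conjunct2, THEN conjunct1]
  CW_structure_def[THEN iffD1, THEN conjunct2, THEN conjunct2, THEN conjunct2, THEN conjunct1]
  CW_structure_def[THEN iffD1, THEN conjunct2, THEN conjunct2, THEN conjunct2, THEN conjunct2]

lemma CW_cells_disjoint:
  assumes "CW_structure X C" "d \<in> C m" "e \<in> C n" "x \<in> d" "x \<in> e"
  shows "m = n \<and> d = e"
  using CW_structureD(3)[OF assms(1)] assms(2-5) by blast

text \<open>Compactness of the disc makes its image closed in the Hausdorff space; splitting the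
  disc into open disc and sphere gives the covering of that image by \<open>e\<close> and finitely
  many lower cells.\<close>

lemma CW_cell_closure:
  assumes CW: "CW_structure Y C" and e: "e \<in> C n"
  obtains \<phi> where "continuous_map (subtopology (Euclidean_space n) (closed_disc n)) Y \<phi>"
    "homeomorphic_map (subtopology (Euclidean_space n) (open_disc n)) (subtopology Y e) \<phi>"
    "e \<subseteq> \<phi> ` closed_disc n" "closedin Y (\<phi> ` closed_disc n)"
    "\<exists>D. finite D \<and> D \<subseteq> (\<Union>m<n. C m) \<and> \<phi> ` bdry_sphere n \<subseteq> \<Union>D \<and> \<phi> ` closed_disc n \<subseteq> e \<union> \<Union>D"
    "e \<subseteq> topspace Y" "e \<noteq> {}"
proof -
  have H: "Hausdorff_space Y" and eY: "e \<subseteq> topspace Y"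
    using CW_structureD(1,2)[OF CW] e by auto
  obtain \<phi> D where \<phi>: "continuous_map (subtopology (Euclidean_space n) (closed_disc n)) Y \<phi>"
    and hom: "homeomorphic_map (subtopology (Euclidean_space n) (open_disc n)) (subtopology Y e) \<phi>"
    and D: "finite D" "D \<subseteq> (\<Union>m<n. C m)" "\<phi> ` bdry_sphere n \<subseteq> \<Union>D"
    using CW_structureD(4)[OF CW, rule_format, OF e] by blast
  have img: "\<phi> ` open_disc n = e"
    using homeomorphic_imp_surjective_map[OF hom] eY open_disc_sub[of n]
    by (simp add: Int_absorb1)
  have disc: "closed_disc n = open_disc n \<union> bdry_sphere n"
    by (auto simp: open_disc_def bdry_sphere_def closed_disc_def)
  have "compactin (subtopology (Euclidean_space n) (closed_disc n)) (closed_disc n)"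
    using compactin_closed_disc
    by (simp add: compactin_subtopology subtopology_Euclidean_space closed_disc_sub)
  then have "closedin Y (\<phi> ` closed_disc n)"
    using image_compactin \<phi> H compactin_imp_closedin by blast
  moreover have "(\<lambda>i. 0) \<in> open_disc n"
    by (simp add: open_disc_def topspace_Euclidean_space)
  then have "e \<noteq> {}" using img by blast
  moreover have "e \<subseteq> \<phi> ` closed_disc n" "\<phi> ` closed_disc n \<subseteq> e \<union> \<Union>D"
    using img D(3) unfolding disc by auto
  ultimately show thesis
    using that[of \<phi>] \<phi> hom D eY by blast
qed

text \<open>One point is chosen in every cell. A closed cell meets only finitely many cells, so by
  the weak topology every set of chosen points is closed; and a closed discrete subset of a compact
  space is finite.\<close>

lemma compact_CW_finite_cells:
  assumes CW: "CW_structure Y C" and comp: "compact_space Y"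
  shows "finite (Sigma UNIV C)"
proof -
  note H = CW_structureD(1)[OF CW] and disj = CW_cells_disjoint[OF CW]
    and weak = CW_structureD(5)[OF CW, rule_format]
  have ne: "e \<noteq> {}" "e \<subseteq> topspace Y" if "e \<in> C n" for n e
    using CW_cell_closure[OF CW that] by metis+
  define pt where "pt = (\<lambda>c::nat \<times> 'a set. SOME x. x \<in> snd c)"
  have pt: "pt (n, e) \<in> e" if "e \<in> C n" for n e
    using ne[OF that] by (auto simp: pt_def some_in_eq)
  define P where "P = pt ` Sigma UNIV C"
  have PY: "P \<subseteq> topspace Y" using pt ne by (auto simp: P_def) blast
  have P1: "finite (P \<inter> d)" if "d \<in> C m" for m d
  proof (rule finite_subset)
    show "P \<inter> d \<subseteq> {pt (m, d)}"
    proof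
      fix x assume x: "x \<in> P \<inter> d"
      then obtain k e where e: "e \<in> C k" "x = pt (k, e)" by (auto simp: P_def)
      then show "x \<in> {pt (m, d)}" using disj[OF that e(1), of x] pt[OF e(1)] x by simp
    qed
  qed simp
  have clo: "closedin Y A" if "A \<subseteq> P" for A
  proof (rule weak)
    show "A \<subseteq> topspace Y" using that PY by blast
    fix n e assume e: "e \<in> C n"
    obtain \<phi> D where c: "closedin Y (\<phi> ` closed_disc n)" "e \<subseteq> \<phi> ` closed_disc n"
      and D: "finite D" "D \<subseteq> (\<Union>m<n. C m)" "\<phi> ` closed_disc n \<subseteq> e \<union> \<Union>D"
      using CW_cell_closure[OF CW e] by metis
    have "Y closure_of e \<subseteq> e \<union> \<Union>D"
      using closure_of_minimal[OF c(2,1)] D by blast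
    then have "A \<inter> Y closure_of e \<subseteq> (P \<inter> e) \<union> (\<Union>d\<in>D. P \<inter> d)"
      using that by blast
    moreover have "finite ((P \<inter> e) \<union> (\<Union>d\<in>D. P \<inter> d))"
    proof (intro finite_UnI finite_UN_I)
      fix d assume "d \<in> D"
      then obtain m where "d \<in> C m" using D(2) by auto
      then show "finite (P \<inter> d)" by (rule P1)
    qed (use P1[OF e] D in auto)
    ultimately have "finite (A \<inter> Y closure_of e)" using finite_subset by blast
    moreover have "A \<inter> Y closure_of e \<subseteq> topspace Y" using that PY by blast
    ultimately show "closedin Y (A \<inter> Y closure_of e)"
      using H closedin_Hausdorff_finite by blast
  qed
  have "finite P"
  proof (cases "P = {}")
    case False
    \<comment> \<open>\<open>U p\<close> contains no point of \<open>P\<close> except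
      \<open>p\<close>, so a subcover must retain every \<open>U p\<close>.\<close>
    define U where "U = (\<lambda>p. topspace Y - (P - {p}))"
    have "\<exists>\<F>. finite \<F> \<and> \<F> \<subseteq> U ` P \<and> topspace Y \<subseteq> \<Union>\<F>"
      using comp[unfolded compact_space_alt]
    proof (rule allE[where x = "U ` P"], elim impE)
      show "(\<forall>V\<in>U ` P. openin Y V) \<and> topspace Y \<subseteq> \<Union> (U ` P)"
        using False clo by (auto simp: U_def intro!: openin_diff)
    qed blast
    then obtain Q where "finite Q" "Q \<subseteq> P" "topspace Y \<subseteq> \<Union> (U ` Q)"
      by (metis finite_subset_image)
    moreover have "P \<subseteq> Q"
    proof
      fix p assume p: "p \<in> P"
      then obtain q where "q \<in> Q" "p \<in> U q" using calculation(3) PY by auto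
      then show "p \<in> Q" using p by (auto simp: U_def)
    qed
    ultimately show ?thesis using finite_subset by blast
  qed simp
  moreover have "inj_on pt (Sigma UNIV C)"
  proof (rule inj_onI, clarsimp)
    fix m d n e assume "d \<in> C m" "e \<in> C n" "pt (m, d) = pt (n, e)"
    then show "m = n \<and> d = e" using disj[of d m e n "pt (m, d)"] pt[of d m] pt[of e n] by simp
  qed
  ultimately show ?thesis
    unfolding P_def using finite_imageD by blast
qed

text \<open>Cells are attached one at a time, in order of dimension, starting from the basepoint.
  The last hypothesis, that all cells of lower dimension are present, keeps the boundary of each
  attached cell inside the part already treated.\<close>

lemma diagonal_equalizer_subcomplex:
  assumes CW: "CW_structure Y C" and comp: "compact_space Y" and y0: "{y0} \<in> C 0"
    and "finite \<D>" "\<D> \<subseteq> Sigma UNIV C" "(0, {y0}) \<in> \<D>"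
    and "\<And>n e m d. \<lbrakk>(n, e) \<in> \<D>; d \<in> C m; m < n\<rbrakk> \<Longrightarrow> (m, d) \<in> \<D>"
  shows "closedin Y (\<Union>(snd ` \<D>)) \<and> (\<exists>G. diagonal_equalizer (subtopology Y (\<Union>(snd ` \<D>))) y0 G)"
  using assms(4-)
proof (induction "card \<D>" arbitrary: \<D> rule: less_induct)
  case less
  note H = CW_structureD(1)[OF CW] and disj = CW_cells_disjoint[OF CW]
  have y0Y: "y0 \<in> topspace Y" using CW_cell_closure[OF CW y0] by auto
  show ?case
  proof (cases "\<D> = {(0, {y0})}")
    case True
    let ?S = "subtopology Y {y0}"
    have "diagonal_equalizer ?S y0 snd"
      unfolding diagonal_equalizer_def
    proof (intro conjI exI[of _ "topspace (prod_topology ?S ?S)"])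
      show "openin (prod_topology ?S ?S) (topspace (prod_topology ?S ?S))" by (rule openin_topspace)
    qed (use y0Y in \<open>auto simp: continuous_map_snd\<close>)
    moreover have "closedin Y {y0}" by (rule closedin_Hausdorff_finite[OF H]) (use y0Y in auto)
    ultimately show ?thesis using True by auto
  next
    case False
    define N where "N = Max (fst ` \<D>)"
    have Nmax: "fst c \<le> N" if "c \<in> \<D>" for c
      unfolding N_def using less.prems(1) that by (intro Max_ge) auto
    \<comment> \<open>A cell of the top dimension is removed; only cells of strictly higher
      dimension would require it, so the closure condition survives. The basepoint cell stays: for
      \<open>N = 0\<close> another cell exists because \<open>\<D>\<close> is not the
      singleton.\<close>
    have "\<exists>e. (N, e) \<in> \<D> \<and> (N, e) \<noteq> (0, {y0})"
    proof (cases "N = 0")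
      case True
      obtain c where "c \<in> \<D>" "c \<noteq> (0, {y0})" using False less.prems(3) by blast
      then show ?thesis using Nmax[of c] True by (cases c) auto
    next
      case N: False
      have "N \<in> fst ` \<D>" unfolding N_def using less.prems by (intro Max_in) auto
      then show ?thesis using N by auto
    qed
    then obtain e where e: "(N, e) \<in> \<D>" "(N, e) \<noteq> (0, {y0})" by blast
    define \<D>' where "\<D>' = \<D> - {(N, e)}"
    define T where "T = \<Union>(snd ` \<D>')"
    have TU: "\<Union>(snd ` \<D>) = T \<union> e" using e(1) by (auto simp: T_def \<D>'_def)
    have "closedin Y T \<and> (\<exists>G. diagonal_equalizer (subtopology Y T) y0 G)"
      unfolding T_def
    proof (rule less.hyps)
      show "card \<D>' < card \<D>" unfolding \<D>'_def using less.prems(1) e(1) by (rule card_Diff1_less)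
      show "finite \<D>'" "\<D>' \<subseteq> Sigma UNIV C" "(0, {y0}) \<in> \<D>'" using less.prems e by (auto simp: \<D>'_def)
      show "(m, d) \<in> \<D>'" if "(n, e') \<in> \<D>'" "d \<in> C m" "m < n" for n e' m d
        using less.prems(4)[of n e' d m] Nmax[of "(n, e')"] that by (auto simp: \<D>'_def)
    qed
    then obtain G' where clT: "closedin Y T" and G': "diagonal_equalizer (subtopology Y T) y0 G'" by blast
    have eC: "e \<in> C N" using less.prems e by blast
    obtain \<phi> D where \<phi>: "continuous_map (subtopology (Euclidean_space N) (closed_disc N)) Y \<phi>"
      and hom: "homeomorphic_map (subtopology (Euclidean_space N) (open_disc N)) (subtopology Y e) \<phi>"
      and clo: "e \<subseteq> \<phi> ` closed_disc N" "closedin Y (\<phi> ` closed_disc N)"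
      and D: "D \<subseteq> (\<Union>m<N. C m)" "\<phi> ` bdry_sphere N \<subseteq> \<Union>D" "\<phi> ` closed_disc N \<subseteq> e \<union> \<Union>D"
      and eY: "e \<subseteq> topspace Y"
      using CW_cell_closure[OF CW eC] by metis
    have DT: "\<Union>D \<subseteq> T"
    proof -
      have "d \<subseteq> T" if "d \<in> D" for d
      proof -
        obtain m where m: "m < N" "d \<in> C m" using D(1) \<open>d \<in> D\<close> by auto
        then have "(m, d) \<in> \<D>'" using less.prems(4)[OF e(1)] by (auto simp: \<D>'_def)
        then show ?thesis by (force simp: T_def)
      qed
      then show ?thesis by blast
    qed
    \<comment> \<open>Replacing \<open>e\<close> by its closed cell adds only points of
      \<open>\<Union>D\<close>, hence of \<open>T\<close>; therefore the union is closed.\<close>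
    have "T \<union> e = T \<union> \<phi> ` closed_disc N" using clo D DT by blast
    then have cl: "closedin Y (T \<union> e)" using clT clo(2) by (simp add: closedin_Un)
    let ?Y = "subtopology Y (T \<union> e)"
    have eT: "e \<inter> T = {}"
    proof (rule ccontr)
      assume "e \<inter> T \<noteq> {}"
      then obtain x m d where "x \<in> e" "x \<in> d" "(m, d) \<in> \<D>'" by (auto simp: T_def)
      then show False using disj[of d m e N x] eC less.prems(2) by (auto simp: \<D>'_def)
    qed
    have top: "topspace ?Y = T \<union> e" using closedin_subset[OF cl] by auto
    then have diff: "topspace ?Y - T = e" using eT by auto
    have "\<exists>G. diagonal_equalizer ?Y y0 G"
    proof (rule diagonal_equalizer_attach_cell)
      show "compact_space ?Y"
        using cl comp by (simp add: closedin_compact_space compact_space_subtopology)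
      show "Hausdorff_space ?Y" using H by (rule Hausdorff_space_subtopology)
      show "closedin ?Y T" using clT cl by (simp add: closedin_closed_subtopology)
      show "y0 \<in> T" using less.prems(3) e(2) by (force simp: T_def \<D>'_def)
      show "diagonal_equalizer (subtopology ?Y T) y0 G'"
        using G' by (simp add: subtopology_subtopology Int_absorb1)
      show "continuous_map (subtopology (Euclidean_space N) (closed_disc N)) ?Y \<phi>"
      proof (rule continuous_map_into_subtopology[OF \<phi>])
        have "\<phi> ` closed_disc N \<subseteq> T \<union> e" using D(3) DT by blast
        then show "\<phi> \<in> topspace (subtopology (Euclidean_space N) (closed_disc N)) \<rightarrow> T \<union> e" by auto
      qed
      show "homeomorphic_map (subtopology (Euclidean_space N) (open_disc N)) (subtopology ?Y (topspace ?Y - T)) \<phi>"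
        unfolding diff using hom by (simp add: subtopology_subtopology Int_absorb1)
      show "\<phi> ` bdry_sphere N \<subseteq> T" using D(2) DT by blast
    qed
    then show ?thesis using cl TU by auto
  qed
qed

lemma compact_cellular_diagonal_equalizer:
  assumes "cellular_space Y y0" and comp: "compact_space Y"
  obtains G where "diagonal_equalizer Y y0 G"
proof -
  obtain C where CW: "CW_structure Y C" and y0: "{y0} \<in> C 0"
    using assms unfolding cellular_space_def by blast
  have "\<Union>(snd ` Sigma UNIV C) = topspace Y"
    unfolding CW_structureD(2)[OF CW, symmetric]
  proof (rule subset_antisym; rule subsetI)
    fix x assume "x \<in> (\<Union>n. \<Union>(C n))"
    then obtain n e where "e \<in> C n" "x \<in> e" by blast
    then have "e \<in> snd ` Sigma UNIV C" by force
    then show "x \<in> \<Union>(snd ` Sigma UNIV C)" using \<open>x \<in> e\<close> by blast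
  qed auto
  moreover have "\<exists>G. diagonal_equalizer (subtopology Y (\<Union>(snd ` Sigma UNIV C))) y0 G"
    by (rule diagonal_equalizer_subcomplex[OF CW comp y0 compact_CW_finite_cells[OF CW comp], THEN conjunct2])
       (use y0 in auto)
  ultimately show thesis using that by auto
qed

section \<open>Coincidences and clusters\<close>

text \<open>Induction on a set \<open>J\<close> of members whose coincidences with all of
  \<open>M\<close> are already local. Coincidences of values are retained along the way, since those
  that are not yet local are needed later; in the end \<open>J\<close> is all of
  \<open>M\<close>.\<close>

lemma homotope_to_local_equality:
  assumes G: "diagonal_equalizer Y y0 G" and x0: "x0 \<in> topspace X" and M: "finite M"
    and maps: "\<And>a. a \<in> M \<Longrightarrow> continuous_map X Y a \<and> a x0 = y0"
  obtains D where "\<And>a. a \<in> M \<Longrightarrow> homotopic_with (\<lambda>k. k x0 = y0) X Y a (D a)"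
    "\<And>a a' x. \<lbrakk>a \<in> M; a' \<in> M; x \<in> topspace X; a x = a' x\<rbrakk> \<Longrightarrow>
       \<exists>W. openin X W \<and> x \<in> W \<and> (\<forall>x'\<in>W. D a x' = D a' x')"
proof -
  let ?P = "\<lambda>k. k x0 = y0"
  obtain U where hG: "homotopic_with (\<lambda>k. k (y0, y0) = y0) (prod_topology Y Y) Y snd G"
    and U: "openin (prod_topology Y Y) U" "\<And>p. p \<in> topspace Y \<Longrightarrow> (p, p) \<in> U"
      "\<And>p z. (p, z) \<in> U \<Longrightarrow> G (p, z) = G (p, p)"
    using G unfolding diagonal_equalizer_def by blast
  have "\<exists>D. (\<forall>a\<in>M. homotopic_with ?P X Y a (D a)) \<and>
      (\<forall>a\<in>M. \<forall>a'\<in>M. \<forall>x\<in>topspace X. a x = a' x \<longrightarrow> D a x = D a' x) \<and>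
      (\<forall>a\<in>J. \<forall>a'\<in>M. \<forall>x\<in>topspace X. a x = a' x \<longrightarrow>
         (\<exists>W. openin X W \<and> x \<in> W \<and> (\<forall>x'\<in>W. D a x' = D a' x')))"
    if "J \<subseteq> M" for J
    using finite_subset[OF that M] that
  proof (induction J rule: finite_induct)
    case empty
    show ?case using maps by (intro exI[of _ "\<lambda>a. a"]) auto
  next
    case (insert j J)
    then obtain D where "(\<forall>a\<in>M. homotopic_with ?P X Y a (D a)) \<and>
      (\<forall>a\<in>M. \<forall>a'\<in>M. \<forall>x\<in>topspace X. a x = a' x \<longrightarrow> D a x = D a' x) \<and>
      (\<forall>a\<in>J. \<forall>a'\<in>M. \<forall>x\<in>topspace X. a x = a' x \<longrightarrow>
         (\<exists>W. openin X W \<and> x \<in> W \<and> (\<forall>x'\<in>W. D a x' = D a' x')))"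
      using insert.prems by (auto dest: insert.IH)
    then have hD: "\<And>a. a \<in> M \<Longrightarrow> homotopic_with ?P X Y a (D a)"
      and eq: "\<And>a a' x. \<lbrakk>a \<in> M; a' \<in> M; x \<in> topspace X; a x = a' x\<rbrakk> \<Longrightarrow> D a x = D a' x"
      and loc: "\<And>a a' x. \<lbrakk>a \<in> J; a' \<in> M; x \<in> topspace X; a x = a' x\<rbrakk> \<Longrightarrow>
         \<exists>W. openin X W \<and> x \<in> W \<and> (\<forall>x'\<in>W. D a x' = D a' x')"
      by blast+
    have j: "j \<in> M" using insert by simp
    have cD: "continuous_map X Y (D a)" and D0: "D a x0 = y0" if "a \<in> M" for a
      using hD[OF that] homotopic_with_imp_continuous_maps homotopic_with_imp_property by blast+
    \<comment> \<open>Coinciding values stay coinciding, as \<open>D' a x\<close> depends on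
      \<open>D a x\<close> and \<open>x\<close> only. If \<open>a x = j x\<close>, then near
      \<open>x\<close> the pair \<open>(D j, D a)\<close> stays in \<open>U\<close>, where
      \<open>G\<close> depends only on the first entry, so \<open>D' a\<close> and
      \<open>D' j\<close> agree there.\<close>
    define D' where "D' = (\<lambda>a x. G (D j x, D a x))"
    have cp: "continuous_map X (prod_topology Y Y) (\<lambda>x. (D j x, D a x))" if "a \<in> M" for a
      using cD j that by (intro continuous_map_pairedI) auto
    show ?case
    proof (intro exI[of _ D'] conjI ballI impI)
      fix a assume a: "a \<in> M"
      have "homotopic_with ?P X Y (snd \<circ> (\<lambda>x. (D j x, D a x))) (G \<circ> (\<lambda>x. (D j x, D a x)))"
        by (rule homotopic_with_compose_continuous_map_right[OF hG cp[OF a]]) (simp add: D0 j a)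
      then have "homotopic_with ?P X Y (D a) (D' a)" by (simp add: o_def D'_def)
      then show "homotopic_with ?P X Y a (D' a)" using hD[OF a] homotopic_with_trans by blast
    next
      fix a a' x assume "a \<in> M" "a' \<in> M" "x \<in> topspace X" "a x = a' x"
      then have "D a x = D a' x" by (rule eq)
      then show "D' a x = D' a' x" by (simp add: D'_def)
    next
      fix a a' x assume a: "a \<in> insert j J" "a' \<in> M" "x \<in> topspace X" "a x = a' x"
      show "\<exists>W. openin X W \<and> x \<in> W \<and> (\<forall>x'\<in>W. D' a x' = D' a' x')"
      proof (cases "a = j")
        case True
        let ?W = "topspace X \<inter> (\<lambda>x. (D j x, D a' x)) -` U"
        have "openin X ?W" by (rule openin_continuous_map_vimage[OF cp[OF a(2)] U(1)])
        moreover have "D j x = D a' x" using eq[OF j a(2,3)] a(4) True by simp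
        moreover have "D j x \<in> topspace Y"
          using continuous_map_image_subset_topspace[OF cD[OF j]] a(3) by blast
        ultimately show ?thesis
          using U(2)[of "D j x"] a(3) True U(3) by (intro exI[of _ ?W]) (auto simp: D'_def)
      next
        case False
        then obtain W where "openin X W" "x \<in> W" "\<forall>x'\<in>W. D a x' = D a' x'"
          using loc[of a a' x] a by auto
        then show ?thesis by (intro exI[of _ W]) (auto simp: D'_def)
      qed
    qed
  qed
  from this[OF subset_refl] obtain D where
      "\<forall>a\<in>M. homotopic_with ?P X Y a (D a)"
      "\<forall>a\<in>M. \<forall>a'\<in>M. \<forall>x\<in>topspace X. a x = a' x \<longrightarrow>
         (\<exists>W. openin X W \<and> x \<in> W \<and> (\<forall>x'\<in>W. D a x' = D a' x'))"
    by (elim exE conjE)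
  then show thesis by (intro that[of D]) simp_all
qed

section \<open>Fine maps to a simplex and chains of linked points\<close>

definition vertex_linked :: "('a \<Rightarrow> nat \<Rightarrow> real) \<Rightarrow> 'a set \<Rightarrow> 'a rel" where
  "vertex_linked \<phi> V = {(x, y). x \<in> V \<and> y \<in> V \<and> (\<exists>e. \<phi> x e \<noteq> 0 \<and> \<phi> y e \<noteq> 0)}"

lemma finite_open_subcover:
  assumes "compact_space X" "\<And>x. x \<in> topspace X \<Longrightarrow> openin X (U x) \<and> x \<in> U x"
  obtains Q where "finite Q" "Q \<subseteq> topspace X" "topspace X \<subseteq> (\<Union>x\<in>Q. U x)"
proof -
  have "\<exists>\<F>. finite \<F> \<and> \<F> \<subseteq> U ` topspace X \<and> topspace X \<subseteq> \<Union>\<F>"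
    using assms(1)[unfolded compact_space_alt]
  proof (rule allE[where x = "U ` topspace X"], elim impE)
    show "(\<forall>V\<in>U ` topspace X. openin X V) \<and> topspace X \<subseteq> \<Union> (U ` topspace X)"
      using assms(2) by auto
  qed blast
  then show thesis using that by (metis finite_subset_image)
qed

text \<open>\<open>\<phi>\<close> is a partition of unity subordinate to balls of radius \<epsilon>
  for a pseudometric \<open>d\<close>. Points with a common nonzero coordinate are within 2
  \<epsilon>, so a cluster, that is a class of \<open>(vertex_linked \<phi> V)\<^sup>*\<close>, of
  at most \<open>n\<close> points is too small to leave some \<open>N c\<close>.\<close>

lemma cluster_map_exists:
  assumes comp: "compact_space X" and haus: "Hausdorff_space X" and ne: "topspace X \<noteq> {}"
    and N: "\<And>x. x \<in> topspace X \<Longrightarrow> openin X (N x) \<and> x \<in> N x"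
  obtains E and \<phi> :: "'a \<Rightarrow> nat \<Rightarrow> real" where "finite E" "E \<noteq> {}" "continuous_map X (simplex_space E) \<phi>"
    "\<forall>V x. finite V \<and> V \<subseteq> topspace X \<and> card V \<le> n \<and> x \<in> V \<longrightarrow>
       (\<exists>c\<in>topspace X. \<forall>y. (x, y) \<in> (vertex_linked \<phi> V)\<^sup>* \<longrightarrow> y \<in> N c)"
proof -
  have normal: "normal_space X"
    using comp haus by (simp add: compact_Hausdorff_or_regular_imp_normal_space)
  have "\<exists>f. continuous_map X euclideanreal f \<and> f c = 1 \<and> (\<forall>x\<in>topspace X - N c. f x = (0::real))"
    if c: "c \<in> topspace X" for c
  proof -
    have "closedin X (topspace X - N c)" "closedin X {c}" "disjnt (topspace X - N c) {c}"
      using N[OF c] haus c by (auto simp: closedin_Hausdorff_singleton)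
    then obtain f where "continuous_map X (top_of_set {0..1::real}) f"
        "f ` (topspace X - N c) \<subseteq> {0}" "f ` {c} \<subseteq> {1}"
      using Urysohn_lemma[OF normal, of "topspace X - N c" "{c}" 0 1] by auto
    then show ?thesis
      by (intro exI[of _ f]) (auto intro: continuous_map_into_fulltopology)
  qed
  then obtain f :: "'a \<Rightarrow> 'a \<Rightarrow> real" where
    f: "\<And>c. c \<in> topspace X \<Longrightarrow> continuous_map X euclideanreal (f c) \<and> f c c = 1"
    and f0: "\<And>c x. \<lbrakk>c \<in> topspace X; x \<in> topspace X; x \<notin> N c\<rbrakk> \<Longrightarrow> f c x = 0"
    by (metis DiffI)
  obtain Q where Q: "finite Q" "Q \<subseteq> topspace X" "topspace X \<subseteq> (\<Union>c\<in>Q. topspace X \<inter> f c -` {1/2<..})"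
  proof (rule finite_open_subcover[OF comp, of "\<lambda>c. topspace X \<inter> f c -` {1/2<..}"])
    show "openin X (topspace X \<inter> f c -` {1/2<..}) \<and> c \<in> topspace X \<inter> f c -` {1/2<..}"
      if "c \<in> topspace X" for c
      using f[OF that] that by (auto intro!: openin_continuous_map_vimage[where Y = euclideanreal])
  qed blast
  \<comment> \<open>\<open>d\<close> is a continuous pseudometric for which the cover \<open>N\<close> has a Lebesgue number; this avoids
    metrizability of \<open>X\<close>.\<close>
  define d where "d = (\<lambda>x y. \<Sum>c\<in>Q. \<bar>f c x - f c y\<bar>)"
  have dsym: "d x y = d y x" for x y by (simp add: d_def abs_minus_commute)
  have dtri: "d x z \<le> d x y + d y z" for x y z
    unfolding d_def sum.distrib[symmetric] by (intro sum_mono) auto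
  have d0: "d x x = 0" for x by (simp add: d_def)
  have cd: "continuous_map X euclideanreal (d x)" for x
    unfolding d_def using Q f by (intro continuous_intros) auto
  \<comment> \<open>For some \<open>c\<close> in \<open>Q\<close> the function \<open>f c\<close>
    exceeds 1/2 at \<open>x\<close>, and it vanishes outside \<open>N c\<close>; so the points
    outside have distance more than 1/2 from \<open>x\<close>.\<close>
  have lebesgue: "\<exists>c\<in>topspace X. \<forall>y\<in>topspace X. d x y \<le> 1/2 \<longrightarrow> y \<in> N c" if x: "x \<in> topspace X" for x
  proof -
    obtain c where c: "c \<in> Q" "f c x > 1/2" using Q(3) x by auto
    have "y \<in> N c" if "y \<in> topspace X" "d x y \<le> 1/2" for y
    proof (rule ccontr)
      assume "y \<notin> N c"
      then have "f c y = 0" using f0 c Q that by auto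
      moreover have "\<bar>f c x - f c y\<bar> \<le> d x y"
        unfolding d_def by (rule member_le_sum) (use c Q in auto)
      ultimately show False using c that by auto
    qed
    then show ?thesis using c Q by blast
  qed
  \<comment> \<open>A chain needs at most as many links as \<open>vertex_linked\<close> has pairs,
    hence at most \<open>n * n\<close>; with links of length 2 \<epsilon> it stays within 1/2. The
    added 1 covers \<open>n = 0\<close>.\<close>
  define \<epsilon> :: real where "\<epsilon> = 1 / (4 * (real (n * n) + 1))"
  have \<epsilon>: "\<epsilon> > 0" "2 * \<epsilon> * real (n * n) \<le> 1/2"
  proof -
    show "\<epsilon> > 0" by (simp add: \<epsilon>_def add_nonneg_pos)
    have "2 * \<epsilon> * (real (n * n) + 1) = 1/2" unfolding \<epsilon>_def
      by (simp add: add_nonneg_pos less_imp_neq[symmetric] field_simps del: of_nat_mult)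
    then show "2 * \<epsilon> * real (n * n) \<le> 1/2" using \<open>\<epsilon> > 0\<close> by (simp only: distrib_left)
  qed
  obtain P where P: "finite P" "P \<subseteq> topspace X" "topspace X \<subseteq> (\<Union>p\<in>P. topspace X \<inter> d p -` {..<\<epsilon>})"
  proof (rule finite_open_subcover[OF comp, of "\<lambda>p. topspace X \<inter> d p -` {..<\<epsilon>}"])
    show "openin X (topspace X \<inter> d p -` {..<\<epsilon>}) \<and> p \<in> topspace X \<inter> d p -` {..<\<epsilon>}"
      if "p \<in> topspace X" for p
      using cd that d0 \<epsilon> by (auto intro!: openin_continuous_map_vimage[where Y = euclideanreal])
  qed blast
  obtain ps where ps: "set ps = P" using P(1) finite_list by blast
  \<comment> \<open>Vertices are natural numbers, so the positions in a list of the centres serve as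
    vertex set; the tents \<open>g\<close>, divided by their positive sum \<open>s\<close>, are the
    barycentric coordinates.\<close>
  define E where "E = {..<length ps}"
  define g where "g = (\<lambda>i x. max 0 (\<epsilon> - d (ps ! i) x))"
  define s where "s = (\<lambda>x. \<Sum>i\<in>E. g i x)"
  define \<phi> where "\<phi> = (\<lambda>x i. if i \<in> E then g i x / s x else 0)"
  have g0: "g i x \<ge> 0" for i x by (simp add: g_def)
  have cg: "continuous_map X euclideanreal (g i)" for i
    unfolding g_def by (intro continuous_intros cd) auto
  have cs: "continuous_map X euclideanreal s"
    unfolding s_def by (intro continuous_intros cg) (auto simp: E_def)
  have spos: "s x > 0" if x: "x \<in> topspace X" for x
  proof -
    obtain p where "p \<in> P" "d p x < \<epsilon>" using P(3) x by auto
    then obtain i where "i \<in> E" "g i x > 0" using ps by (auto simp: in_set_conv_nth E_def g_def)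
    then show ?thesis unfolding s_def using g0 by (intro sum_pos2[of _ i]) (auto simp: E_def)
  qed
  have "continuous_map X (powertop_real UNIV) \<phi>"
    unfolding continuous_map_componentwise_UNIV
  proof
    fix i
    show "continuous_map X euclideanreal (\<lambda>x. \<phi> x i)"
    proof (cases "i \<in> E")
      case True
      then show ?thesis unfolding \<phi>_def using spos
        by (auto intro!: continuous_map_real_divide cg cs simp: less_imp_neq)
          (metis less_irrefl)
    qed (simp add: \<phi>_def)
  qed
  moreover have "\<phi> x \<in> simplex_on E" if x: "x \<in> topspace X" for x
  proof -
    have "g i x \<le> s x" if "i \<in> E" for i
      unfolding s_def by (rule member_le_sum) (use that g0 in \<open>auto simp: E_def\<close>)
    moreover have "(\<Sum>i\<in>E. \<phi> x i) = s x / s x"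
      by (simp add: \<phi>_def s_def flip: sum_divide_distrib)
    ultimately show ?thesis
      using spos[OF x] g0 by (auto simp: simplex_on_def \<phi>_def divide_le_eq_1)
  qed
  ultimately have c\<phi>: "continuous_map X (simplex_space E) \<phi>"
    unfolding simplex_space_def by (auto intro: continuous_map_into_subtopology)
  have linked: "d x y \<le> 2 * \<epsilon>" if "\<phi> x e \<noteq> 0" "\<phi> y e \<noteq> 0" for x y e
  proof -
    have "d (ps ! e) x < \<epsilon>" "d (ps ! e) y < \<epsilon>"
      using that by (auto simp: \<phi>_def g_def max_def split: if_splits)
    then show ?thesis using dtri[of x y "ps ! e"] dsym[of x "ps ! e"] by linarith
  qed
  show thesis
  proof (rule that[of E \<phi>], goal_cases)
    case 4
    show ?case
    proof (intro allI impI; elim conjE)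
      fix V x assume V: "finite V" "V \<subseteq> topspace X" "card V \<le> n" "x \<in> V"
      let ?R = "vertex_linked \<phi> V"
      have RV: "?R \<subseteq> V \<times> V" by (auto simp: vertex_linked_def)
      have finR: "finite ?R" using RV V by (meson finite_SigmaI finite_subset)
      have "card ?R \<le> card (V \<times> V)" using RV V by (intro card_mono) auto
      also have "\<dots> \<le> n * n" using V by (simp add: card_cartesian_product mult_le_mono)
      finally have cR: "card ?R \<le> n * n" .
      have step: "y \<in> V \<and> d x y \<le> 2 * \<epsilon> * real k" if "(x, y) \<in> ?R ^^ k" for k y
        using that
      proof (induction k arbitrary: y)
        case 0
        then show ?case using V d0 by simp
      next
        case (Suc k)
        then obtain z where z: "(x, z) \<in> ?R ^^ k" "(z, y) \<in> ?R" by auto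
        have "d z y \<le> 2 * \<epsilon>" "y \<in> V" using z(2) linked by (auto simp: vertex_linked_def)
        then show ?case using Suc.IH[OF z(1)] dtri[of x y z] by (simp add: algebra_simps)
      qed
      have "y \<in> topspace X \<and> d x y \<le> 1/2" if "(x, y) \<in> ?R\<^sup>*" for y
      proof -
        obtain k where k: "k \<le> card ?R" "(x, y) \<in> ?R ^^ k"
          using \<open>(x, y) \<in> ?R\<^sup>*\<close> rtrancl_finite_eq_relpow[OF finR] by auto
        have "2 * \<epsilon> * real k \<le> 2 * \<epsilon> * real (n * n)"
          using k(1) cR \<epsilon> by (intro mult_left_mono, subst of_nat_le_iff) auto
        then show ?thesis using step[OF k(2)] \<epsilon>(2) V by auto
      qed
      then show "\<exists>c\<in>topspace X. \<forall>y. (x, y) \<in> ?R\<^sup>* \<longrightarrow> y \<in> N c"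
        using lebesgue[of x] V by blast
    qed
  qed (use ne P(3) ps c\<phi> in \<open>auto simp: E_def lessThan_empty_iff\<close>)
qed

section \<open>Ensembles and their products\<close>

lemma frag_extend_induced_hom: "frag_extend f (induced_hom \<phi> A) = frag_extend (f \<circ> \<phi>) A"
  unfolding induced_hom_def by (rule frag_extend_compose[unfolded o_def[of frag_of]])

lemma induced_hom_compose: "induced_hom \<psi> (induced_hom \<phi> A) = induced_hom (\<psi> \<circ> \<phi>) A"
  by (simp add: induced_hom_def[of \<psi>] frag_extend_induced_hom) (simp add: induced_hom_def o_def)

lemma induced_hom_cong:
  assumes "\<And>m. m \<in> Poly_Mapping.keys A \<Longrightarrow> \<phi> m = \<psi> m"
  shows "induced_hom \<phi> A = induced_hom \<psi> A"
  unfolding induced_hom_def by (rule frag_extend_eq) (simp add: assms)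

lemma induced_hom_frag_extend: "induced_hom \<phi> (frag_extend f A) = frag_extend (\<lambda>a. induced_hom \<phi> (f a)) A"
  unfolding induced_hom_def frag_extend_def[of f] frag_extend_def[of "\<lambda>a. frag_extend _ (f a)"]
  by (simp add: frag_extend_sum frag_extend_cmul)

lemma induced_hom_diff: "induced_hom \<phi> (A - B) = induced_hom \<phi> A - induced_hom \<phi> B"
  by (simp add: induced_hom_def frag_extend_diff)

lemma induced_hom_of [simp]: "induced_hom \<phi> (frag_of m) = frag_of (\<phi> m)"
  by (simp add: induced_hom_def)

lemma frag_cmul_sum_left: "frag_cmul (\<Sum>i\<in>I. c i) x = (\<Sum>i\<in>I. frag_cmul (c i) x)"
  by (induction I rule: infinite_finite_induct) (auto simp: frag_cmul_distrib)

lemma lookup_induced_hom: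
  "Poly_Mapping.lookup (induced_hom \<phi> A) t =
     (\<Sum>k | k \<in> Poly_Mapping.keys A \<and> \<phi> k = t. Poly_Mapping.lookup A k)"
proof -
  have "Poly_Mapping.lookup (induced_hom \<phi> A) t =
      (\<Sum>k\<in>Poly_Mapping.keys A. if \<phi> k = t then Poly_Mapping.lookup A k else 0)"
    unfolding induced_hom_def frag_extend_def lookup_sum
    by (rule sum.cong) (auto simp: lookup_single)
  also have "\<dots> = (\<Sum>k | k \<in> Poly_Mapping.keys A \<and> \<phi> k = t. Poly_Mapping.lookup A k)"
    by (simp add: sum.If_cases Int_def)
  finally show ?thesis .
qed

section \<open>Images of tensor products of ensembles\<close>

text \<open>This is \<open>glue_tensor\<close> with an arbitrary index set and an arbitrary function
  \<open>g\<close> on basis tensors; the generality makes it stable under maps of the factors and of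
  the target.\<close>

definition tensor_image ::
  "'i set \<Rightarrow> ('i \<Rightarrow> ('m \<Rightarrow>\<^sub>0 int)) \<Rightarrow> (('i \<Rightarrow> 'm) \<Rightarrow> 'n) \<Rightarrow> ('n \<Rightarrow>\<^sub>0 int)" where
  "tensor_image I A g =
     (\<Sum>\<sigma> \<in> (\<Pi>\<^sub>E i\<in>I. Poly_Mapping.keys (A i)).
        frag_cmul (\<Prod>i\<in>I. Poly_Mapping.lookup (A i) (\<sigma> i)) (frag_of (g \<sigma>)))"

lemma glue_tensor_eq: "glue_tensor \<F> A = tensor_image \<F> A (glue_maps \<F>)"
  by (simp add: glue_tensor_def tensor_image_def)

lemma tensor_image_cong:
  assumes "\<And>i. i \<in> I \<Longrightarrow> A i = A' i"
    and "\<And>\<sigma>. \<sigma> \<in> (\<Pi>\<^sub>E i\<in>I. Poly_Mapping.keys (A i)) \<Longrightarrow> g \<sigma> = g' \<sigma>"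
  shows "tensor_image I A g = tensor_image I A' g'"
proof -
  have "(\<Pi>\<^sub>E i\<in>I. Poly_Mapping.keys (A i)) = (\<Pi>\<^sub>E i\<in>I. Poly_Mapping.keys (A' i))"
    by (rule PiE_cong) (simp add: assms)
  then show ?thesis
    unfolding tensor_image_def using assms by (intro sum.cong) (auto intro!: arg_cong2[where f = frag_cmul])
qed

lemma induced_hom_tensor_image:
  assumes "finite I"
  shows "induced_hom \<psi> (tensor_image I A g) = tensor_image I A (\<psi> \<circ> g)"
proof -
  have "finite (\<Pi>\<^sub>E i\<in>I. Poly_Mapping.keys (A i))" using assms by (intro finite_PiE) auto
  then show ?thesis
    unfolding tensor_image_def induced_hom_def
    by (simp add: frag_extend_sum frag_extend_cmul)
qed

text \<open>A coefficient of an induced ensemble is a sum over a fibre; a product of such sums is a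
  sum over choice functions, and collecting these by their images gives the claim.\<close>

lemma tensor_image_induced_hom:
  assumes I: "finite I"
  shows "tensor_image I (\<lambda>i. induced_hom (\<psi> i) (A i)) g =
         tensor_image I A (\<lambda>\<sigma>. g (\<lambda>i\<in>I. \<psi> i (\<sigma> i)))"
proof -
  define K where "K = (\<lambda>i. Poly_Mapping.keys (A i))"
  let ?B = "\<lambda>i. induced_hom (\<psi> i) (A i)"
  let ?c = "\<lambda>\<tau>. frag_cmul (\<Prod>i\<in>I. Poly_Mapping.lookup (?B i) (\<tau> i)) (frag_of (g \<tau>))"
  let ?d = "\<lambda>\<sigma>. \<Prod>i\<in>I. Poly_Mapping.lookup (A i) (\<sigma> i)"
  let ?h = "\<lambda>\<sigma>. \<lambda>i\<in>I. \<psi> i (\<sigma> i)"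
  \<comment> \<open>Coefficients may cancel in the induced ensembles, so their keys can be smaller
    than the images \<open>J i\<close>; summing over \<open>J\<close> adds only terms with
    coefficient 0.\<close>
  define J where "J = (\<lambda>i. \<psi> i ` K i)"
  have finK: "finite (K i)" for i by (simp add: K_def)
  have finPK: "finite (Pi\<^sub>E I K)" and finPJ: "finite (Pi\<^sub>E I J)"
    using I finK by (auto intro!: finite_PiE simp: J_def)
  have keysJ: "Poly_Mapping.keys (?B i) \<subseteq> J i" for i
    using keys_frag_extend[of "\<lambda>m. frag_of (\<psi> i m)" "A i"]
    by (auto simp: induced_hom_def J_def K_def)
  have fib: "{\<sigma> \<in> Pi\<^sub>E I K. ?h \<sigma> = \<tau>} = (\<Pi>\<^sub>E i\<in>I. {k \<in> K i. \<psi> i k = \<tau> i})" if "\<tau> \<in> Pi\<^sub>E I J" for \<tau>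
  proof -
    have "?h \<sigma> = \<tau> \<longleftrightarrow> (\<forall>i\<in>I. \<psi> i (\<sigma> i) = \<tau> i)" for \<sigma>
      using that by (auto simp: fun_eq_iff PiE_def extensional_def)
    then show ?thesis by (auto simp: PiE_iff extensional_def)
  qed
  have "tensor_image I ?B g = (\<Sum>\<tau>\<in>Pi\<^sub>E I J. ?c \<tau>)"
    unfolding tensor_image_def
  proof (rule sum.mono_neutral_left[OF finPJ])
    show "(\<Pi>\<^sub>E i\<in>I. Poly_Mapping.keys (?B i)) \<subseteq> Pi\<^sub>E I J"
      using keysJ by (intro PiE_mono)
    show "\<forall>\<tau>\<in>Pi\<^sub>E I J - (\<Pi>\<^sub>E i\<in>I. Poly_Mapping.keys (?B i)). ?c \<tau> = 0"
    proof
      fix \<tau> assume "\<tau> \<in> Pi\<^sub>E I J - (\<Pi>\<^sub>E i\<in>I. Poly_Mapping.keys (?B i))"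
      then obtain i where "i \<in> I" "\<tau> i \<notin> Poly_Mapping.keys (?B i)" by (auto simp: PiE_iff)
      then have "(\<Prod>i\<in>I. Poly_Mapping.lookup (?B i) (\<tau> i)) = 0"
        using I by (auto simp: in_keys_iff intro!: prod_zero)
      then show "?c \<tau> = 0" by simp
    qed
  qed
  also have "\<dots> = (\<Sum>\<tau>\<in>Pi\<^sub>E I J. \<Sum>\<sigma> | \<sigma> \<in> Pi\<^sub>E I K \<and> ?h \<sigma> = \<tau>. frag_cmul (?d \<sigma>) (frag_of (g (?h \<sigma>))))"
  proof (rule sum.cong[OF refl])
    fix \<tau> assume \<tau>: "\<tau> \<in> Pi\<^sub>E I J"
    have "(\<Prod>i\<in>I. Poly_Mapping.lookup (?B i) (\<tau> i)) =
        (\<Prod>i\<in>I. \<Sum>k\<in>{k \<in> K i. \<psi> i k = \<tau> i}. Poly_Mapping.lookup (A i) k)"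
      by (simp add: lookup_induced_hom K_def)
    also have "\<dots> = (\<Sum>\<sigma>\<in>(\<Pi>\<^sub>E i\<in>I. {k \<in> K i. \<psi> i k = \<tau> i}). ?d \<sigma>)"
      using I finK by (intro prod_sum_PiE) auto
    also have "\<dots> = (\<Sum>\<sigma> | \<sigma> \<in> Pi\<^sub>E I K \<and> ?h \<sigma> = \<tau>. ?d \<sigma>)"
      using fib[OF \<tau>] by simp
    finally show "?c \<tau> = (\<Sum>\<sigma> | \<sigma> \<in> Pi\<^sub>E I K \<and> ?h \<sigma> = \<tau>. frag_cmul (?d \<sigma>) (frag_of (g (?h \<sigma>))))"
      by (simp add: frag_cmul_sum_left)
  qed
  also have "\<dots> = (\<Sum>\<sigma>\<in>Pi\<^sub>E I K. frag_cmul (?d \<sigma>) (frag_of (g (?h \<sigma>))))"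
    by (rule sum.group[OF finPK finPJ]) (auto simp: J_def)
  finally show ?thesis by (simp add: tensor_image_def K_def)
qed

text \<open>On the keys of \<open>A\<close> the function \<open>f\<close> factors through
  \<open>\<rho>\<close>, so \<open>frag_extend f A\<close> can be computed from
  \<open>induced_hom \<rho> A\<close>. With restriction to a finite set as \<open>\<rho>\<close>,
  this is how the filtration condition on \<open>A\<close> is exploited.\<close>

lemma frag_extend_factor_eq_0:
  assumes "induced_hom \<rho> A = 0"
    and "\<And>a a'. \<lbrakk>a \<in> Poly_Mapping.keys A; a' \<in> Poly_Mapping.keys A; \<rho> a = \<rho> a'\<rbrakk> \<Longrightarrow> f a = f a'"
  shows "frag_extend f A = 0"
proof -
  define f' where "f' = (\<lambda>w. f (SOME a. a \<in> Poly_Mapping.keys A \<and> \<rho> a = w))"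
  have "f' (\<rho> a) = f a" if "a \<in> Poly_Mapping.keys A" for a
  proof -
    have "(SOME a'. a' \<in> Poly_Mapping.keys A \<and> \<rho> a' = \<rho> a) \<in> Poly_Mapping.keys A \<and>
        \<rho> (SOME a'. a' \<in> Poly_Mapping.keys A \<and> \<rho> a' = \<rho> a) = \<rho> a"
      by (rule someI[of _ a]) (simp add: that)
    then show ?thesis unfolding f'_def using assms(2) that by blast
  qed
  then have "frag_extend f A = frag_extend (f' \<circ> \<rho>) A"
    by (intro frag_extend_eq) simp
  also have "\<dots> = 0" by (simp add: assms(1) flip: frag_extend_induced_hom)
  finally show ?thesis .
qed

section \<open>Clusters and their faces\<close>

text \<open>The face spanned by the carriers of all points in the cluster of \<open>x\<close>. Its
  vertex set serves as the label of the cluster, which makes the set of clusters into a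
  layout.\<close>

definition cluster_face :: "('a \<Rightarrow> nat \<Rightarrow> real) \<Rightarrow> 'a set \<Rightarrow> 'a \<Rightarrow> nat set" where
  "cluster_face \<phi> V x = {e. \<exists>y. (x, y) \<in> (vertex_linked \<phi> V)\<^sup>* \<and> \<phi> y e \<noteq> 0}"

context
  fixes \<phi> :: "'a \<Rightarrow> nat \<Rightarrow> real" and V :: "'a set" and E :: "nat set"
  assumes \<phi>: "\<And>x. x \<in> V \<Longrightarrow> \<phi> x \<in> simplex_on E"
begin

lemma vertex_linked_rtrancl_in: "(x, y) \<in> (vertex_linked \<phi> V)\<^sup>* \<Longrightarrow> x \<in> V \<Longrightarrow> y \<in> V"
  by (induction rule: rtrancl_induct) (auto simp: vertex_linked_def)

text \<open>A shared vertex \<open>e\<close> belongs to the carrier of some point in either cluster;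
  these two points are linked, which joins the clusters.\<close>

lemma cluster_face_meet:
  assumes x: "x \<in> V" "x' \<in> V" and e: "e \<in> cluster_face \<phi> V x" "e \<in> cluster_face \<phi> V x'"
  shows "(x, x') \<in> (vertex_linked \<phi> V)\<^sup>*" and "cluster_face \<phi> V x = cluster_face \<phi> V x'"
proof -
  let ?R = "vertex_linked \<phi> V"
  have sym: "sym (?R\<^sup>*)" by (rule sym_rtrancl) (auto simp: sym_def vertex_linked_def)
  obtain y y' where y: "(x, y) \<in> ?R\<^sup>*" "\<phi> y e \<noteq> 0" "(x', y') \<in> ?R\<^sup>*" "\<phi> y' e \<noteq> 0"
    using e by (auto simp: cluster_face_def)
  have "y \<in> V" "y' \<in> V" using y x vertex_linked_rtrancl_in by blast+
  then have "(y, y') \<in> ?R" using y by (auto simp: vertex_linked_def)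
  moreover have "(y', x') \<in> ?R\<^sup>*" using sym y by (auto dest: symD)
  ultimately show *: "(x, x') \<in> ?R\<^sup>*" using y(1) by (meson rtrancl.rtrancl_into_rtrancl rtrancl_trans)
  then have "(x', x) \<in> ?R\<^sup>*" using sym by (auto dest: symD)
  then show "cluster_face \<phi> V x = cluster_face \<phi> V x'"
    using * by (auto simp: cluster_face_def intro: rtrancl_trans)
qed

lemma cluster_face_nonempty:
  assumes "x \<in> V" shows "\<exists>e\<in>E. \<phi> x e \<noteq> 0 \<and> e \<in> cluster_face \<phi> V x"
proof -
  have "(\<Sum>e\<in>E. \<phi> x e) \<noteq> 0" using \<phi>[OF assms] by (simp add: simplex_on_def)
  then obtain e where "e \<in> E" "\<phi> x e \<noteq> 0" by (metis sum.neutral)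
  then show ?thesis by (auto simp: cluster_face_def)
qed

lemma cluster_face_subset: "x \<in> V \<Longrightarrow> cluster_face \<phi> V x \<subseteq> E"
  using \<phi> vertex_linked_rtrancl_in by (fastforce simp: cluster_face_def simplex_on_def)

lemma cluster_face_eq_imp_linked:
  assumes "x \<in> V" "x' \<in> V" "cluster_face \<phi> V x = cluster_face \<phi> V x'"
  shows "(x, x') \<in> (vertex_linked \<phi> V)\<^sup>*"
proof -
  obtain e where "e \<in> cluster_face \<phi> V x" using cluster_face_nonempty[OF assms(1)] by blast
  then show ?thesis using cluster_face_meet(1)[of x x' e] assms by simp
qed

lemma layout_cluster_face: "layout E (cluster_face \<phi> V ` V)"
proof -
  have "F \<inter> G = {}" if "F \<in> cluster_face \<phi> V ` V" "G \<in> cluster_face \<phi> V ` V" "F \<noteq> G" for F G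
  proof (rule ccontr)
    assume "F \<inter> G \<noteq> {}"
    then obtain e x x' where "x \<in> V" "x' \<in> V" "F = cluster_face \<phi> V x" "G = cluster_face \<phi> V x'" "e \<in> F" "e \<in> G"
      using \<open>F \<in> _\<close> \<open>G \<in> _\<close> by auto
    then show False using cluster_face_meet(2)[of x x' e] \<open>F \<noteq> G\<close> by simp
  qed
  moreover have "F \<noteq> {} \<and> F \<subseteq> E" if "F \<in> cluster_face \<phi> V ` V" for F
    using that cluster_face_nonempty cluster_face_subset by fastforce
  ultimately show ?thesis
    unfolding layout_def by simp
qed

lemma in_cluster_simplex:
  assumes E: "finite E" and x: "x \<in> V"
  shows "\<phi> x \<in> simplex_on (cluster_face \<phi> V x)"
proof -
  have "\<phi> x e = 0" if "e \<notin> cluster_face \<phi> V x" for e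
    using that by (auto simp: cluster_face_def)
  moreover have "(\<Sum>e\<in>cluster_face \<phi> V x. \<phi> x e) = (\<Sum>e\<in>E. \<phi> x e)"
    using calculation cluster_face_subset[OF x] E by (intro sum.mono_neutral_left) auto
  ultimately show ?thesis using \<phi>[OF x] by (auto simp: simplex_on_def)
qed

lemma in_cluster_simplex_unique:
  assumes E: "finite E" and x: "x \<in> V" and F: "F \<in> cluster_face \<phi> V ` V" "\<phi> x \<in> simplex_on F"
  shows "F = cluster_face \<phi> V x"
proof -
  obtain e where e: "\<phi> x e \<noteq> 0" "e \<in> cluster_face \<phi> V x" using cluster_face_nonempty[OF x] by blast
  then have "e \<in> F" using F(2) by (auto simp: simplex_on_def)
  moreover obtain x' where "x' \<in> V" "F = cluster_face \<phi> V x'" using F(1) by blast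
  ultimately show ?thesis using cluster_face_meet(2)[of x x' e] e(2) x by simp
qed

text \<open>Evaluation at the points of \<open>V\<close> uses only the restriction of
  \<open>S\<close> to the faces of the clusters. These form a layout, so fissility turns the
  restriction into a product, and each factor is then evaluated on the points of its own
  cluster.\<close>

lemma fissile_cluster_decomposition:
  assumes E: "finite E" and V: "finite V" and S: "fissile E W S"
  shows "induced_hom (\<lambda>s. \<lambda>x\<in>V. s (\<phi> x) (d x)) S =
    tensor_image (cluster_face \<phi> V ` V)
      (\<lambda>F. induced_hom (\<lambda>s. \<lambda>x\<in>{x\<in>V. cluster_face \<phi> V x = F}. s (\<phi> x) (d x)) S)
      (\<lambda>\<tau>. \<lambda>x\<in>V. \<tau> (cluster_face \<phi> V x) x)"
proof -
  let ?F = "cluster_face \<phi> V" let ?\<F> = "?F ` V"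
  define ev where "ev = (\<lambda>s :: (nat \<Rightarrow> real) \<Rightarrow> 'b \<Rightarrow> 'c. \<lambda>x\<in>V. s (\<phi> x) (d x))"
  define \<psi> where "\<psi> = (\<lambda>F (s :: (nat \<Rightarrow> real) \<Rightarrow> 'b \<Rightarrow> 'c). \<lambda>x\<in>{x\<in>V. ?F x = F}. s (\<phi> x) (d x))"
  let ?g = "\<lambda>\<tau>. \<lambda>x\<in>V. \<tau> (?F x) x"
  have inU: "\<phi> x \<in> layout_union ?\<F>" if "x \<in> V" for x
    using in_cluster_simplex[OF E that] that by (auto simp: layout_union_def)
  have "induced_hom ev S = induced_hom ev (restrict_ensemble S (layout_union ?\<F>))"
    unfolding restrict_ensemble_def induced_hom_compose
    by (rule induced_hom_cong) (auto simp: ev_def inU fun_eq_iff)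
  also have "restrict_ensemble S (layout_union ?\<F>) =
      tensor_image ?\<F> (\<lambda>F. restrict_ensemble S (simplex_on F)) (glue_maps ?\<F>)"
    using S layout_cluster_face by (simp add: fissile_def glue_tensor_eq)
  also have "induced_hom ev \<dots> =
      tensor_image ?\<F> (\<lambda>F. restrict_ensemble S (simplex_on F)) (ev \<circ> glue_maps ?\<F>)"
    using V by (simp add: induced_hom_tensor_image)
  also have "\<dots> = tensor_image ?\<F> (\<lambda>F. restrict_ensemble S (simplex_on F))
      (\<lambda>\<sigma>. ?g (\<lambda>F\<in>?\<F>. \<psi> F (\<sigma> F)))"
  proof (rule tensor_image_cong[OF refl])
    fix \<sigma> :: "nat set \<Rightarrow> (nat \<Rightarrow> real) \<Rightarrow> 'b \<Rightarrow> 'c"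
    \<comment> \<open>Each \<open>\<phi> x\<close> lies in exactly one of the faces, so the
      description in \<open>glue_maps\<close> selects the factor of the cluster of
      \<open>x\<close>.\<close>
    have "(THE F. F \<in> ?\<F> \<and> \<phi> x \<in> simplex_on F) = ?F x" if "x \<in> V" for x
    proof (rule the_equality)
      show "F = ?F x" if "F \<in> ?\<F> \<and> \<phi> x \<in> simplex_on F" for F
        using in_cluster_simplex_unique[OF E \<open>x \<in> V\<close>] that by blast
    qed (use that in_cluster_simplex[OF E] in blast)
    then show "(ev \<circ> glue_maps ?\<F>) \<sigma> = ?g (\<lambda>F\<in>?\<F>. \<psi> F (\<sigma> F))"
      by (auto simp: ev_def glue_maps_def \<psi>_def inU fun_eq_iff)
  qed
  also have "\<dots> = tensor_image ?\<F> (\<lambda>F. induced_hom (\<psi> F) (restrict_ensemble S (simplex_on F))) ?g"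
    using V by (simp add: tensor_image_induced_hom)
  also have "\<dots> = tensor_image ?\<F> (\<lambda>F. induced_hom (\<psi> F) S) ?g"
  proof (rule tensor_image_cong[OF _ refl])
    fix F
    show "induced_hom (\<psi> F) (restrict_ensemble S (simplex_on F)) = induced_hom (\<psi> F) S"
      unfolding restrict_ensemble_def induced_hom_compose
      by (rule induced_hom_cong) (use in_cluster_simplex[OF E] in \<open>auto simp: \<psi>_def fun_eq_iff\<close>)
  qed
  finally show ?thesis unfolding ev_def \<psi>_def .
qed

end

section \<open>Realization of fissile ensembles\<close>

text \<open>As a compact Hausdorff space is regular, \<open>y\<close> has a neighbourhood whose
  closure \<open>K\<close> is compact and still sent into \<open>U\<close> by \<open>s t\<close>;
  the subbasic set for \<open>K\<close> and \<open>U\<close> then controls all nearby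
  parameters.\<close>

lemma compact_open_eval:
  assumes cP: "compact_space P" and hP: "Hausdorff_space P"
    and s: "continuous_map T (compact_open P p0 Q q0) s"
  shows "continuous_map (prod_topology T P) Q (\<lambda>x. s (fst x) (snd x))"
proof -
  have sb: "s t \<in> based_maps P p0 Q q0" if "t \<in> topspace T" for t
    using continuous_map_image_subset_topspace[OF s] that by (auto simp: compact_open_def)
  then have sc: "continuous_map P Q (s t)" if "t \<in> topspace T" for t
    using that by (auto simp: based_maps_def unbased_maps_def)
  show ?thesis
    unfolding continuous_map_def
  proof (intro conjI allI impI)
    show "(\<lambda>x. s (fst x) (snd x)) \<in> topspace (prod_topology T P) \<rightarrow> topspace Q"
      using continuous_map_image_subset_topspace[OF sc] by fastforce
    fix U assume U: "openin Q U"
    let ?Z = "{x \<in> topspace (prod_topology T P). s (fst x) (snd x) \<in> U}"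
    show "openin (prod_topology T P) ?Z"
    proof (subst openin_subopen, intro ballI)
      fix x assume x: "x \<in> ?Z"
      obtain t y where ty: "x = (t, y)" "t \<in> topspace T" "y \<in> topspace P" "s t y \<in> U" using x by auto
      let ?O = "{y \<in> topspace P. s t y \<in> U}"
      have "openin P ?O" using sc[OF ty(2)] U by (simp add: continuous_map_def)
      then have "closedin P (topspace P - ?O)" by blast
      then obtain V where V: "openin P V" "y \<in> V" "disjnt (topspace P - ?O) (P closure_of V)"
        using compact_Hausdorff_imp_regular_space[OF cP hP, unfolded regular_space, rule_format, of "topspace P - ?O" y] ty
        by auto
      let ?K = "P closure_of V"
      have K: "compactin P ?K" using cP by (simp add: closedin_compact_space)
      have VK: "V \<subseteq> ?K" using closure_of_subset[OF openin_subset[OF V(1)]] .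
      have "s t ` ?K \<subseteq> U"
        using V(3) closure_of_subset_topspace[of P V] by (fastforce simp: disjnt_iff)
      let ?G = "{f \<in> based_maps P p0 Q q0. f ` ?K \<subseteq> U}"
      have "openin (compact_open P p0 Q q0) ?G"
        unfolding compact_open_def by (rule topology_generated_by_Basis) (use K U in blast)
      then have "openin T {t \<in> topspace T. s t \<in> ?G}" using s unfolding continuous_map_def by blast
      moreover have "{t \<in> topspace T. s t \<in> ?G} \<times> V \<subseteq> ?Z"
        using VK openin_subset[OF V(1)] by (auto simp: image_subset_iff)
      moreover have "x \<in> {t \<in> topspace T. s t \<in> ?G} \<times> V"
        using ty sb \<open>s t ` ?K \<subseteq> U\<close> V(2) by auto
      ultimately show "\<exists>Ta. openin (prod_topology T P) Ta \<and> x \<in> Ta \<and> Ta \<subseteq> ?Z"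
        using V(1) by (intro exI[of _ "{t \<in> topspace T. s t \<in> ?G} \<times> V"]) (simp add: openin_prod_Times_iff)
    qed
  qed
qed

lemma topspace_simplex_space [simp]: "topspace (simplex_space E) = simplex_on E"
  by (simp add: simplex_space_def)

lemma simplex_on_convex:
  assumes t: "t \<in> simplex_on E" and u: "u \<in> simplex_on E" and \<tau>: "\<tau> \<in> {0..1}"
  shows "(\<lambda>e. (1 - \<tau>) * t e + \<tau> * u e) \<in> simplex_on E"
proof -
  have "(1 - \<tau>) * t e + \<tau> * u e \<le> 1" for e
    by (rule convex_bound_le) (use assms in \<open>auto simp: simplex_on_def\<close>)
  then show ?thesis
    using assms by (auto simp: simplex_on_def sum.distrib simp flip: sum_distrib_left)
qed

text \<open>The simplex is contracted linearly to \<open>t0 = \<phi> x0\<close>, which deforms the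
  map to \<open>s t0 \<circ> a\<close>; and \<open>s t0\<close> is homotopic to \<open>b\<close>
  since \<open>s\<close> takes values in the component of \<open>b\<close>. Each \<open>s t\<close>
  is based, so the basepoint stays fixed.\<close>

lemma simplex_realization_homotopic:
  fixes X :: "'a topology"
  assumes cY: "compact_space Y" and hY: "Hausdorff_space Y" and x0: "x0 \<in> topspace X"
    and \<phi>: "continuous_map X (simplex_space E) \<phi>"
    and s: "continuous_map (simplex_space E) (map_component Y y0 Z z0 b) s"
    and a: "continuous_map X Y a" "a x0 = y0"
  shows "homotopic_with (\<lambda>k. k x0 = z0) X Z (\<lambda>x. s (\<phi> x) (a x)) (b \<circ> a)"
proof -
  let ?I = "top_of_set {0..1::real}"
  define t0 where "t0 = \<phi> x0"
  have \<phi>s: "\<phi> x \<in> simplex_on E" if "x \<in> topspace X" for x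
    using continuous_map_image_subset_topspace[OF \<phi>] that by auto
  have t0: "t0 \<in> simplex_on E" using \<phi>s x0 by (simp add: t0_def)
  have s': "continuous_map (simplex_space E) (compact_open Y y0 Z z0) s"
    using s unfolding map_component_def by (rule continuous_map_into_fulltopology)
  have st: "s t \<in> based_maps Y y0 Z z0 \<and> based_homotopic Y y0 Z z0 (s t) b" if "t \<in> simplex_on E" for t
    using continuous_map_image_subset_topspace[OF s] that by (auto simp: map_component_def)
  have "homotopic_with (\<lambda>k. k x0 = z0) X Z (\<lambda>x. s (\<phi> x) (a x)) (\<lambda>x. s t0 (a x))"
  proof (subst homotopic_with, goal_cases)
    case 2
    let ?\<theta> = "\<lambda>y::real \<times> 'a. \<lambda>e. (1 - fst y) * \<phi> (snd y) e + fst y * t0 e"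
    show ?case
    proof (intro exI conjI ballI)
      have "continuous_map (prod_topology ?I X) (powertop_real UNIV) ?\<theta>"
        unfolding continuous_map_componentwise_UNIV
      proof
        fix e
        have "continuous_map X euclideanreal (\<lambda>x. \<phi> x e)"
          using \<phi> by (auto simp: simplex_space_def continuous_map_in_subtopology continuous_map_componentwise_UNIV)
        from continuous_map_compose[OF continuous_map_snd this]
        show "continuous_map (prod_topology ?I X) euclideanreal (\<lambda>y. ?\<theta> y e)"
          by (intro continuous_intros continuous_map_into_fulltopology[OF continuous_map_fst]) (auto simp: o_def)
      qed
      then have "continuous_map (prod_topology ?I X) (simplex_space E) ?\<theta>"
        unfolding simplex_space_def
        by (rule continuous_map_into_subtopology) (use simplex_on_convex \<phi>s t0 in auto)
      moreover have "continuous_map (prod_topology ?I X) Y (\<lambda>y. a (snd y))"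
        using continuous_map_compose[OF continuous_map_snd a(1)] by (simp add: o_def)
      ultimately have "continuous_map (prod_topology ?I X) (prod_topology (simplex_space E) Y) (\<lambda>y. (?\<theta> y, a (snd y)))"
        by (rule continuous_map_pairedI)
      from continuous_map_compose[OF this compact_open_eval[OF cY hY s']]
      show "continuous_map (prod_topology ?I X) Z (\<lambda>y. s (?\<theta> y) (a (snd y)))" by (simp add: o_def)
      show "(\<lambda>y. s (?\<theta> y) (a (snd y))) (t, x0) = z0" if "t \<in> {0..1}" for t
        using st[OF simplex_on_convex[OF \<phi>s[OF x0] t0 that]] a by (simp add: based_maps_def)
    qed auto
  qed (use x0 in simp)
  moreover have "homotopic_with (\<lambda>k. k x0 = z0) X Z (s t0 \<circ> a) (b \<circ> a)"
    by (rule homotopic_with_compose_continuous_map_right[of "\<lambda>k. k y0 = z0"])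
       (use st[OF t0] a in \<open>auto simp: based_homotopic_def\<close>)
  ultimately show ?thesis unfolding o_def by (rule homotopic_with_trans)
qed

section \<open>Homotopy classes and homomorphisms on ensembles\<close>

lemma homotopy_class_eqI:
  assumes "f \<in> based_maps P p0 Q q0" "g \<in> based_maps P p0 Q q0" "based_homotopic P p0 Q q0 f g"
  shows "homotopy_class P p0 Q q0 f = homotopy_class P p0 Q q0 g"
  using assms
  by (auto simp: homotopy_class_def based_homotopy_rel_def based_homotopic_def
      intro: homotopic_with_trans homotopic_with_symD)

lemma based_maps_restrictI:
  assumes "homotopic_with (\<lambda>k. k p0 = q0) P Q f g" "p0 \<in> topspace P"
  shows "restrict f (topspace P) \<in> based_maps P p0 Q q0"
    and "restrict g (topspace P) \<in> based_maps P p0 Q q0"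
    and "based_homotopic P p0 Q q0 (restrict f (topspace P)) (restrict g (topspace P))"
proof -
  have "continuous_map P Q f" "continuous_map P Q g" "f p0 = q0" "g p0 = q0"
    using homotopic_with_imp_continuous_maps[OF assms(1)] homotopic_with_imp_property[OF assms(1)] by auto
  moreover have "continuous_map P Q (restrict k (topspace P))" if "continuous_map P Q k" for k
    by (rule continuous_map_eq[OF that]) simp
  ultimately show "restrict f (topspace P) \<in> based_maps P p0 Q q0"
    "restrict g (topspace P) \<in> based_maps P p0 Q q0"
    using assms(2) by (auto simp: based_maps_def unbased_maps_def)
  show "based_homotopic P p0 Q q0 (restrict f (topspace P)) (restrict g (topspace P))"
    unfolding based_homotopic_def
    by (rule homotopic_with_eq[OF assms(1)]) (use assms(2) in auto)
qed

text \<open>Links the sums in the definition of order with homomorphisms on ensembles. The induction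
  over the keys also carries the containment of keys in \<open>S\<close>, as \<open>k\<close> is
  known to be multiplicative only on the carrier.\<close>

lemma hom_frag_extend:
  assumes L: "comm_group L" and k: "k \<in> hom (free_Abelian_group S) L"
    and g: "\<And>a. a \<in> Poly_Mapping.keys A \<Longrightarrow> Poly_Mapping.keys (g a) \<subseteq> S"
  shows "k (frag_extend g A) =
    finprod L (\<lambda>a. k (g a) [^]\<^bsub>L\<^esub> Poly_Mapping.lookup A a) (Poly_Mapping.keys A)"
proof -
  interpret L: comm_group L by (rule L)
  interpret k: group_hom "free_Abelian_group S" L k
    by (simp add: group_hom_def group_hom_axioms_def k)
  let ?c = "Poly_Mapping.lookup A"
  have kg: "k (g a) \<in> carrier L" if "a \<in> Poly_Mapping.keys A" for a
    using g[OF that] k.hom_closed by simp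
  have kc: "k (frag_cmul n (g a)) = k (g a) [^]\<^bsub>L\<^esub> n" if "a \<in> Poly_Mapping.keys A" for a and n :: int
    using k.hom_int_pow[of "g a" n] g[OF that] by simp
  have "k (\<Sum>a\<in>I. frag_cmul (?c a) (g a)) = finprod L (\<lambda>a. k (g a) [^]\<^bsub>L\<^esub> ?c a) I \<and>
      Poly_Mapping.keys (\<Sum>a\<in>I. frag_cmul (?c a) (g a)) \<subseteq> S"
    if "I \<subseteq> Poly_Mapping.keys A" for I
    using finite_subset[OF that finite_keys] that
  proof (induction I rule: finite_induct)
    case empty
    then show ?case using k.hom_one by simp
  next
    case (insert i I)
    let ?r = "\<Sum>a\<in>I. frag_cmul (?c a) (g a)"
    have IH: "k ?r = finprod L (\<lambda>a. k (g a) [^]\<^bsub>L\<^esub> ?c a) I" "Poly_Mapping.keys ?r \<subseteq> S"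
      using insert by auto
    have gi: "Poly_Mapping.keys (frag_cmul (?c i) (g i)) \<subseteq> S"
      using g[of i] keys_cmul[of "?c i" "g i"] insert.prems by auto
    have "k (frag_cmul (?c i) (g i) + ?r) = k (frag_cmul (?c i) (g i)) \<otimes>\<^bsub>L\<^esub> k ?r"
      using k.hom_mult[of "frag_cmul (?c i) (g i)" ?r] gi IH(2) by simp
    moreover have "finprod L (\<lambda>a. k (g a) [^]\<^bsub>L\<^esub> ?c a) (insert i I) =
        k (g i) [^]\<^bsub>L\<^esub> ?c i \<otimes>\<^bsub>L\<^esub> finprod L (\<lambda>a. k (g a) [^]\<^bsub>L\<^esub> ?c a) I"
      using insert.hyps insert.prems kg by (intro L.finprod_insert) auto
    moreover have "Poly_Mapping.keys (frag_cmul (?c i) (g i) + ?r) \<subseteq> S"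
      using keys_add[of "frag_cmul (?c i) (g i)" ?r] gi IH(2) by blast
    ultimately show ?case using insert.hyps insert.prems IH(1) kc[of i] by simp
  qed
  then show ?thesis unfolding frag_extend_def by blast
qed

lemma (in comm_group) finprod_int_pow:
  assumes "c \<in> carrier G"
  shows "finprod G (\<lambda>i. c [^] (n i :: int)) I = c [^] (\<Sum>i\<in>I. n i)"
proof (induction I rule: infinite_finite_induct)
  case (insert i I)
  then show ?case using assms by (simp add: int_pow_mult)
qed (auto simp: finprod_infinite)

text \<open>For the empty layout all maps restrict to the one map of the empty set, so the
  restriction retains only the sum of coefficients, whereas the empty tensor product is a single
  basis element with coefficient 1.\<close>

lemma fissile_coefficient_sum:
  assumes "fissile E W S"
  shows "(\<Sum>s\<in>Poly_Mapping.keys S. Poly_Mapping.lookup S s) = 1"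
proof -
  have "restrict_ensemble S (layout_union {}) = glue_tensor {} (\<lambda>F. restrict_ensemble S (simplex_on F))"
    using assms by (simp add: fissile_def layout_def)
  moreover have "restrict_ensemble S (layout_union {}) =
      frag_cmul (\<Sum>s\<in>Poly_Mapping.keys S. Poly_Mapping.lookup S s) (frag_of (\<lambda>_. undefined))"
    by (simp add: restrict_ensemble_def induced_hom_def frag_extend_def layout_union_def frag_cmul_sum_left restrict_def)
  moreover have "glue_tensor {} (\<lambda>F. restrict_ensemble S (simplex_on F)) = frag_of (\<lambda>_. undefined)"
    by (simp add: glue_tensor_def glue_maps_def layout_union_def restrict_def)
  ultimately show ?thesis
    by (metis lookup_frag_cmul lookup_frag_of mult.right_neutral)
qed

section \<open>Vanishing of the realized ensemble on small sets\<close>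

text \<open>The pairs \<open>(\<phi> x, d x)\<close> are at most as many as the points of
  \<open>C\<close>, hence fewer than \<open>q\<close>, and there \<open>S\<close> restricts like the
  constant map. Evaluation along \<open>C\<close> factors through this restriction, also if distinct
  \<open>x\<close> give the same pair.\<close>

lemma small_cluster_restriction:
  assumes S: "frag_of (const_map (simplex_space E) (const_map Y z0)) - S \<in> simplex_filtration Y y0 Z z0 E q"
    and C: "finite C" "card C < q"
    and \<phi>: "\<And>x. x \<in> C \<Longrightarrow> \<phi> x \<in> simplex_on E" and d: "\<And>x. x \<in> C \<Longrightarrow> d x \<in> topspace Y"
  shows "induced_hom (\<lambda>s. \<lambda>x\<in>C. s (\<phi> x) (d x)) S = frag_of (\<lambda>x\<in>C. z0)"
proof -
  define V where "V = (\<lambda>x. (\<phi> x, d x)) ` C"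
  let ?\<rho> = "\<lambda>\<sigma>. restrict (\<lambda>(t, x). \<sigma> t x) V" and ?c = "const_map (simplex_space E) (const_map Y z0)"
  let ?\<kappa> = "\<lambda>w. \<lambda>x\<in>C. w (\<phi> x, d x)"
  have "V \<subseteq> simplex_on E \<times> topspace Y" "finite V" "card V < q"
    using C \<phi> d card_image_le[OF C(1), of "\<lambda>x. (\<phi> x, d x)"] by (auto simp: V_def)
  then have "induced_hom ?\<rho> (frag_of ?c - S) = 0"
    using S unfolding simplex_filtration_def by blast
  then have eq: "induced_hom ?\<rho> S = frag_of (?\<rho> ?c)" by (simp add: induced_hom_diff)
  have "induced_hom (\<lambda>s. \<lambda>x\<in>C. s (\<phi> x) (d x)) S = induced_hom (?\<kappa> \<circ> ?\<rho>) S"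
    by (rule induced_hom_cong) (auto simp: V_def fun_eq_iff)
  also have "\<dots> = frag_of (?\<kappa> (?\<rho> ?c))" by (simp add: eq flip: induced_hom_compose)
  also have "?\<kappa> (?\<rho> ?c) = (\<lambda>x\<in>C. z0)"
    using \<phi> d by (auto simp: V_def fun_eq_iff const_map_def)
  finally show ?thesis .
qed

text \<open>The restriction to \<open>V\<close> depends on \<open>a\<close> only through its values
  at one point per large cluster: clusters with fewer than \<open>q\<close> points contribute the
  basepoint, and each larger one is governed by a point from the hypothesis \<open>clusters\<close>.
  Fewer than \<open>m\<close> clusters are large, so \<open>A\<close> vanishes on those
  points.\<close>

lemma realization_restriction_zero:
  fixes \<phi> :: "'a \<Rightarrow> nat \<Rightarrow> real" and d :: "('a \<Rightarrow> 'b) \<Rightarrow> 'a \<Rightarrow> 'b"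
  assumes E: "finite E" and S: "fissile E (map_component Y y0 Z z0 b) S"
    and sim: "frag_of (const_map (simplex_space E) (const_map Y z0)) - S \<in> simplex_filtration Y y0 Z z0 E q"
    and A: "A \<in> ensemble_filtration X x0 Y y0 m"
    and \<phi>: "\<And>x. x \<in> topspace X \<Longrightarrow> \<phi> x \<in> simplex_on E"
    and d: "\<And>a x. a \<in> Poly_Mapping.keys A \<Longrightarrow> x \<in> topspace X \<Longrightarrow> d a x \<in> topspace Y"
    and V: "finite V" "V \<subseteq> topspace X" "card V < q * m"
    and clusters: "\<And>x. x \<in> V \<Longrightarrow> \<exists>c\<in>topspace X. \<forall>y. (x, y) \<in> (vertex_linked \<phi> V)\<^sup>* \<longrightarrow>
        (\<forall>a\<in>Poly_Mapping.keys A. \<forall>a'\<in>Poly_Mapping.keys A. a c = a' c \<longrightarrow> d a y = d a' y)"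
  shows "restrict_ensemble (frag_extend (\<lambda>a. induced_hom (\<lambda>s. \<lambda>x\<in>topspace X. s (\<phi> x) (d a x)) S) A) V = 0"
proof -
  let ?K = "Poly_Mapping.keys A" and ?F = "cluster_face \<phi> V"
  let ?T = "\<lambda>W a. induced_hom (\<lambda>s. \<lambda>x\<in>W. s (\<phi> x) (d a x)) S"
  let ?C = "\<lambda>F. {x \<in> V. ?F x = F}"
  have \<phi>V: "\<phi> x \<in> simplex_on E" if "x \<in> V" for x using \<phi> V that by auto
  obtain c where c: "\<And>x. x \<in> V \<Longrightarrow> c x \<in> topspace X"
    "\<And>x y a a'. \<lbrakk>x \<in> V; (x, y) \<in> (vertex_linked \<phi> V)\<^sup>*; a \<in> ?K; a' \<in> ?K; a (c x) = a' (c x)\<rbrakk> \<Longrightarrow> d a y = d a' y"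
    using clusters by metis
  define big where "big = {F \<in> ?F ` V. q \<le> card (?C F)}"
  define rep where "rep = (\<lambda>F. SOME x. x \<in> V \<and> ?F x = F)"
  have rep: "rep F \<in> V \<and> ?F (rep F) = F" if "F \<in> ?F ` V" for F
    unfolding rep_def by (rule someI_ex) (use that in auto)
  \<comment> \<open>For the chosen representative of each large cluster, \<open>c\<close> supplies
    the point of \<open>X\<close> that governs the cluster. Such points may coincide and may lie
    outside \<open>V\<close>.\<close>
  define P where "P = (\<lambda>F. c (rep F)) ` big"
  have finbig: "finite big" using V by (simp add: big_def)
  \<comment> \<open>Large clusters are disjoint and have at least \<open>q\<close> points each,
    which together with \<open>card V < q * m\<close> bounds their number.\<close>
  have "q * card big = (\<Sum>F\<in>big. q)" by simp
  also have "\<dots> \<le> (\<Sum>F\<in>big. card (?C F))" by (rule sum_mono) (simp add: big_def)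
  also have "\<dots> = card (\<Union>F\<in>big. ?C F)"
    using V finbig by (intro card_UN_disjoint[symmetric]) auto
  also have "\<dots> \<le> card V" using V by (intro card_mono) auto
  also note V(3)
  finally have "q * card big < q * m" .
  then have "card big < m" by simp
  then have "card P < m" using card_image_le[OF finbig, of "\<lambda>F. c (rep F)"] by (simp add: P_def)
  moreover have "P \<subseteq> topspace X" using c(1) rep by (auto simp: P_def big_def)
  moreover have "finite P" using finbig by (simp add: P_def)
  ultimately have A0: "induced_hom (\<lambda>a. restrict a P) A = 0"
    using A by (simp add: ensemble_filtration_def restrict_ensemble_def)
  have dec: "?T V a = tensor_image (?F ` V) (\<lambda>F. ?T (?C F) a) (\<lambda>\<tau>. \<lambda>x\<in>V. \<tau> (?F x) x)" for a
    by (rule fissile_cluster_decomposition[OF \<phi>V E V(1) S])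
  have "restrict_ensemble (frag_extend (?T (topspace X)) A) V = frag_extend (?T V) A"
  proof -
    have "induced_hom (\<lambda>w. restrict w V) (?T (topspace X) a) = ?T V a" for a
      unfolding induced_hom_compose
      by (rule induced_hom_cong) (use V(2) in \<open>auto simp: fun_eq_iff\<close>)
    then show ?thesis unfolding restrict_ensemble_def induced_hom_frag_extend by simp
  qed
  also have "\<dots> = 0"
  proof (rule frag_extend_factor_eq_0[OF A0])
    fix a a' assume a: "a \<in> ?K" "a' \<in> ?K" and eq: "restrict a P = restrict a' P"
    have "?T (?C F) a = ?T (?C F) a'" if F: "F \<in> ?F ` V" for F
    proof (cases "F \<in> big")
      case True
      then have "c (rep F) \<in> P" by (simp add: P_def)
      then have ac: "a (c (rep F)) = a' (c (rep F))" using eq by (metis restrict_apply')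
      have "d a x = d a' x" if "x \<in> ?C F" for x
      proof -
        have "(rep F, x) \<in> (vertex_linked \<phi> V)\<^sup>*"
          using cluster_face_eq_imp_linked[where V = V and x = "rep F" and x' = x, OF \<phi>V] rep[OF F] that by simp
        then show ?thesis using c(2)[of "rep F" x a a'] rep[OF F] a ac by blast
      qed
      then show ?thesis by (intro induced_hom_cong) (auto simp: fun_eq_iff)
    next
      case False
      then have "card (?C F) < q" using F by (simp add: big_def)
      then have "?T (?C F) g = frag_of (\<lambda>x\<in>?C F. z0)" if g: "g \<in> ?K" for g
        using V \<phi>V d[OF g] by (intro small_cluster_restriction[OF sim]) auto
      then show ?thesis using a by simp
    qed
    then show "?T V a = ?T V a'"
      unfolding dec by (intro tensor_image_cong) auto
  qed
  finally show ?thesis .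
qed

section \<open>Comparison of the orders\<close>

text \<open>The hypothesis \<open>n < q * m + q\<close> matches the filtrations: a set of at most
  \<open>n\<close> points has at most \<open>m\<close> clusters with \<open>q\<close> or more
  points, and \<open>A\<close> vanishes on any \<open>m\<close> points. Hence the realized ensemble
  \<open>B\<close> lies in step \<open>n + 1\<close>, and evaluating \<open>h\<close> on it gives
  the sum for \<open>f\<close> on \<open>A\<close>.\<close>

lemma invariant_order_le_compose:
  fixes X :: "'a topology" and Y :: "'b topology" and Z :: "'c topology"
    and L :: "('l, 'm) monoid_scheme"
  assumes cX: "compact_space X" and hX: "Hausdorff_space X" and x0: "x0 \<in> topspace X"
    and cY: "compact_space Y" and hY: "Hausdorff_space Y"
    and G: "diagonal_equalizer Y y0 G"
    and q: "q \<ge> 1" and b: "b \<in> based_maps Y y0 Z z0"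
    and sim: "strongly_similar Y y0 Z z0 (q - 1) b (const_map Y z0)"
    and L: "comm_group L" and h: "h \<in> homotopy_classes X x0 Z z0 \<rightarrow> carrier L"
    and f: "\<And>a. a \<in> based_maps X x0 Y y0 \<Longrightarrow>
           f (homotopy_class X x0 Y y0 a) =
           h (homotopy_class X x0 Z z0 (compose (topspace X) b a))"
    and n: "invariant_order_le X x0 Z z0 L h n" and qm: "n < q * m + q"
  shows "invariant_order_le X x0 Y y0 L f m"
  unfolding invariant_order_le_def
proof
  interpret L: comm_group L by (rule L)
  fix A assume A: "A \<in> ensemble_filtration X x0 Y y0 (m + 1)"
  let ?K = "Poly_Mapping.keys A" and ?P = "\<lambda>k. k x0 = y0" and ?Q = "\<lambda>k. k x0 = z0"
  let ?cls = "homotopy_class X x0 Z z0" and ?M = "based_maps X x0 Z z0"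
  have KA: "?K \<subseteq> based_maps X x0 Y y0"
    using A by (simp add: ensemble_filtration_def)
  have maps: "continuous_map X Y a \<and> a x0 = y0" if "a \<in> ?K" for a
    using KA that by (auto simp: based_maps_def unbased_maps_def)
  have cb: "continuous_map Y Z b" "b y0 = z0"
    using b by (auto simp: based_maps_def unbased_maps_def)
  obtain D where hD: "\<And>a. a \<in> ?K \<Longrightarrow> homotopic_with ?P X Y a (D a)"
    and loc: "\<And>a a' x. \<lbrakk>a \<in> ?K; a' \<in> ?K; x \<in> topspace X; a x = a' x\<rbrakk> \<Longrightarrow>
       \<exists>W. openin X W \<and> x \<in> W \<and> (\<forall>x'\<in>W. D a x' = D a' x')"
    using homotope_to_local_equality[OF G x0 finite_keys maps] by blast
  have cD: "continuous_map X Y (D a)" and D0: "D a x0 = y0" if "a \<in> ?K" for a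
    using homotopic_with_imp_continuous_maps[OF hD[OF that]]
      homotopic_with_imp_property[OF hD[OF that]] by auto
  \<comment> \<open>The local coincidences are made uniform in the maps: finitely many
    neighbourhoods are intersected, one for each pair agreeing at \<open>x\<close>.\<close>
  have "\<exists>W. openin X W \<and> x \<in> W \<and>
      (\<forall>a\<in>?K. \<forall>a'\<in>?K. a x = a' x \<longrightarrow> (\<forall>y\<in>W. D a y = D a' y))" if x: "x \<in> topspace X" for x
  proof -
    define J where "J = {(a, a') \<in> ?K \<times> ?K. a x = a' x}"
    have finJ: "finite J" unfolding J_def by (rule finite_subset[of _ "?K \<times> ?K"]) auto
    have "\<exists>W. openin X W \<and> x \<in> W \<and> (\<forall>x'\<in>W. D (fst p) x' = D (snd p) x')" if "p \<in> J" for p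
      using loc[of "fst p" "snd p" x] that x by (auto simp: J_def)
    then obtain W where W: "\<And>p. p \<in> J \<Longrightarrow> openin X (W p) \<and> x \<in> W p \<and> (\<forall>x'\<in>W p. D (fst p) x' = D (snd p) x')"
      by metis
    let ?W = "topspace X \<inter> \<Inter>(W ` J)"
    have "openin X ?W"
    proof (cases "J = {}")
      case False
      then have "openin X (\<Inter>(W ` J))" using W finJ by (intro openin_Inter) auto
      then show ?thesis by blast
    qed simp
    moreover have "x \<in> ?W" using W x by simp
    moreover have "D a y = D a' y" if "a \<in> ?K" "a' \<in> ?K" "a x = a' x" "y \<in> ?W" for a a' y
    proof -
      have "(a, a') \<in> J" using that by (simp add: J_def)
      then show ?thesis using W[of "(a, a')"] that(4) by auto
    qed
    ultimately show ?thesis by blast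
  qed
  then have "\<forall>x\<in>topspace X. \<exists>W. openin X W \<and> x \<in> W \<and>
      (\<forall>a\<in>?K. \<forall>a'\<in>?K. a x = a' x \<longrightarrow> (\<forall>y\<in>W. D a y = D a' y))" ..
  then obtain N where N0: "\<forall>x\<in>topspace X. openin X (N x) \<and> x \<in> N x \<and>
      (\<forall>a\<in>?K. \<forall>a'\<in>?K. a x = a' x \<longrightarrow> (\<forall>y\<in>N x. D a y = D a' y))"
    by (rule bchoice[THEN exE])
  have N: "openin X (N x) \<and> x \<in> N x" if "x \<in> topspace X" for x
    using bspec[OF N0 that] by (elim conjE) (rule conjI)
  have ND: "\<forall>a\<in>?K. \<forall>a'\<in>?K. a x = a' x \<longrightarrow> (\<forall>y\<in>N x. D a y = D a' y)"
    if "x \<in> topspace X" for x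
    using bspec[OF N0 that] by (elim conjE)
  have ne: "topspace X \<noteq> {}" using x0 by blast
  obtain E and \<phi> :: "'a \<Rightarrow> nat \<Rightarrow> real" where E: "finite E" "E \<noteq> {}"
    and \<phi>: "continuous_map X (simplex_space E) \<phi>"
    and clusters: "\<forall>V x. finite V \<and> V \<subseteq> topspace X \<and> card V \<le> n \<and> x \<in> V \<longrightarrow>
       (\<exists>c\<in>topspace X. \<forall>y. (x, y) \<in> (vertex_linked \<phi> V)\<^sup>* \<longrightarrow> y \<in> N c)"
    by (rule cluster_map_exists[OF cX hX ne N, where n = n])
  have \<phi>s: "\<phi> x \<in> simplex_on E" if "x \<in> topspace X" for x
    using continuous_map_image_subset_topspace[OF \<phi>] that by auto
  obtain S where S: "fissile E (map_component Y y0 Z z0 b) S"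
    and SR: "frag_of (const_map (simplex_space E) (const_map Y z0)) - S \<in> simplex_filtration Y y0 Z z0 E q"
    using sim E q unfolding strongly_similar_def by auto
  have Sc: "continuous_map (simplex_space E) (map_component Y y0 Z z0 b) s" if "s \<in> Poly_Mapping.keys S" for s
    using S that by (auto simp: fissile_def unbased_maps_def)
  \<comment> \<open>The maps that replace \<open>b \<circ> a\<close>, one for each member of
    \<open>S\<close>; all are homotopic to it, although \<open>D a\<close> takes the place of
    \<open>a\<close>.\<close>
  define \<rho> where "\<rho> = (\<lambda>a (s :: (nat \<Rightarrow> real) \<Rightarrow> 'b \<Rightarrow> 'c). \<lambda>x\<in>topspace X. s (\<phi> x) (D a x))"
  have \<rho>: "\<rho> a s \<in> ?M \<and> ?cls (\<rho> a s) = ?cls (compose (topspace X) b a)"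
    if a: "a \<in> ?K" and s: "s \<in> Poly_Mapping.keys S" for a s
  proof -
    have "homotopic_with ?Q X Z (\<lambda>x. s (\<phi> x) (D a x)) (b \<circ> D a)"
      by (rule simplex_realization_homotopic[OF cY hY x0 \<phi> Sc[OF s] cD[OF a] D0[OF a]])
    moreover have "homotopic_with ?Q X Z (b \<circ> a) (b \<circ> D a)"
      by (rule homotopic_with_compose_continuous_map_left[OF hD[OF a] cb(1)]) (simp add: cb(2))
    ultimately have "homotopic_with ?Q X Z (\<lambda>x. s (\<phi> x) (D a x)) (b \<circ> a)"
      using homotopic_with_trans homotopic_with_symD by blast
    note * = based_maps_restrictI[OF this x0]
    have "restrict (b \<circ> a) (topspace X) = compose (topspace X) b a"
      by (simp add: compose_def o_def)
    then show ?thesis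
      using * homotopy_class_eqI[OF *] by (simp add: \<rho>_def)
  qed
  have h_car: "h (?cls c) \<in> carrier L" if "c \<in> ?M" for c
  proof -
    have "?cls c \<in> homotopy_classes X x0 Z z0"
      unfolding homotopy_class_def homotopy_classes_def by (rule quotientI[OF that])
    then show ?thesis using h by blast
  qed
  have keysR: "Poly_Mapping.keys (induced_hom (\<rho> a) S) \<subseteq> ?M" if "a \<in> ?K" for a
    using keys_frag_extend[of "\<lambda>s. frag_of (\<rho> a s)" S] \<rho>[OF that] by (fastforce simp: induced_hom_def)
  define B where "B = frag_extend (\<lambda>a. induced_hom (\<rho> a) S) A"
  have keysB: "Poly_Mapping.keys B \<subseteq> ?M"
    using keys_frag_extend[of "\<lambda>a. induced_hom (\<rho> a) S" A] keysR unfolding B_def by blast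
  have "B \<in> ensemble_filtration X x0 Z z0 (n + 1)"
    unfolding ensemble_filtration_def
  proof (intro CollectI conjI allI impI; (elim conjE)?)
    show "B \<in> ensembles ?M" using keysB by simp
    fix V assume V: "V \<subseteq> topspace X" "finite V" "card V < n + 1"
    show "restrict_ensemble B V = 0"
      unfolding B_def \<rho>_def
    proof (rule realization_restriction_zero[OF E(1) S SR A \<phi>s])
      show "D a x \<in> topspace Y" if "a \<in> ?K" "x \<in> topspace X" for a x
        using continuous_map_image_subset_topspace[OF cD[OF that(1)]] that(2) by blast
      show "card V < q * (m + 1)" using V(3) qm by simp
      show "\<exists>c\<in>topspace X. \<forall>y. (x, y) \<in> (vertex_linked \<phi> V)\<^sup>* \<longrightarrow>
          (\<forall>a\<in>?K. \<forall>a'\<in>?K. a c = a' c \<longrightarrow> D a y = D a' y)" if xV: "x \<in> V" for x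
      proof -
        have "card V \<le> n" using V(3) by simp
        then obtain c where c: "c \<in> topspace X"
          "\<And>y. (x, y) \<in> (vertex_linked \<phi> V)\<^sup>* \<Longrightarrow> y \<in> N c"
          using clusters[rule_format, of V x] V(1,2) xV by blast
        then show ?thesis using ND[OF c(1)] by blast
      qed
    qed (use V in auto)
  qed
  then have hB: "finprod L (\<lambda>c. h (?cls c) [^]\<^bsub>L\<^esub> Poly_Mapping.lookup B c) (Poly_Mapping.keys B) = \<one>\<^bsub>L\<^esub>"
    using n by (simp add: invariant_order_le_def)
  \<comment> \<open>The linear extension \<open>k\<close> of \<open>h\<close> to ensembles turns the
    products over keys into values of one homomorphism, so that cancellation among the coefficients
    of \<open>B\<close> is taken care of.\<close>
  have "(\<lambda>c. h (?cls c)) ` ?M \<subseteq> carrier L" using h_car by blast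
  then obtain k where k: "k \<in> hom (free_Abelian_group ?M) L"
    and k_of: "\<And>c. c \<in> ?M \<Longrightarrow> k (frag_of c) = h (?cls c)"
    using L.free_Abelian_group_universal[of "\<lambda>c. h (?cls c)" ?M] by blast
  \<comment> \<open>All members of \<open>S\<close> contribute the same value of \<open>h\<close>,
    and the coefficients of \<open>S\<close> sum to 1; hence the realization of \<open>a\<close>
    contributes exactly the value of \<open>f\<close>.\<close>
  have kS: "k (induced_hom (\<rho> a) S) = f (homotopy_class X x0 Y y0 a)" if a: "a \<in> ?K" for a
  proof -
    let ?c = "h (?cls (compose (topspace X) b a))"
    \<comment> \<open>A member of \<open>S\<close> is wanted to see that \<open>?c\<close> is the
      value of \<open>h\<close> on the class of a based map, hence lies in the carrier.\<close>
    have ne: "Poly_Mapping.keys S \<noteq> {}" using fissile_coefficient_sum[OF S] by auto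
    then obtain s where s: "s \<in> Poly_Mapping.keys S" by blast
    have c: "?c \<in> carrier L" using h_car[of "\<rho> a s"] \<rho>[OF a s] by simp
    have "k (induced_hom (\<rho> a) S) =
        finprod L (\<lambda>s. k (frag_of (\<rho> a s)) [^]\<^bsub>L\<^esub> Poly_Mapping.lookup S s) (Poly_Mapping.keys S)"
      unfolding induced_hom_def by (rule hom_frag_extend[OF L k]) (use \<rho>[OF a] in simp)
    also have "\<dots> = finprod L (\<lambda>s. ?c [^]\<^bsub>L\<^esub> Poly_Mapping.lookup S s) (Poly_Mapping.keys S)"
      by (rule L.finprod_cong') (use \<rho>[OF a] k_of c in auto)
    also have "\<dots> = ?c"
      using fissile_coefficient_sum[OF S] c by (simp add: L.finprod_int_pow)
    also have "\<dots> = f (homotopy_class X x0 Y y0 a)" using f KA a by auto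
    finally show ?thesis .
  qed
  have f_car: "f (homotopy_class X x0 Y y0 a) \<in> carrier L" if a: "a \<in> ?K" for a
    using kS[OF a] hom_in_carrier[OF k, of "induced_hom (\<rho> a) S"] keysR[OF a] by simp
  have "finprod L (\<lambda>a. f (homotopy_class X x0 Y y0 a) [^]\<^bsub>L\<^esub> Poly_Mapping.lookup A a) ?K =
      finprod L (\<lambda>a. k (induced_hom (\<rho> a) S) [^]\<^bsub>L\<^esub> Poly_Mapping.lookup A a) ?K"
    by (rule L.finprod_cong') (use kS f_car in auto)
  also have "\<dots> = k B"
    unfolding B_def by (rule hom_frag_extend[OF L k keysR, symmetric])
  also have "\<dots> = k (frag_extend frag_of B)" by (simp flip: frag_expansion)
  also have "\<dots> = finprod L (\<lambda>c. k (frag_of c) [^]\<^bsub>L\<^esub> Poly_Mapping.lookup B c) (Poly_Mapping.keys B)"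
    by (rule hom_frag_extend[OF L k]) (use keysB in auto)
  also have "\<dots> = finprod L (\<lambda>c. h (?cls c) [^]\<^bsub>L\<^esub> Poly_Mapping.lookup B c) (Poly_Mapping.keys B)"
    by (rule L.finprod_cong') (use keysB k_of h_car in auto)
  finally show "finprod L (\<lambda>a. f (homotopy_class X x0 Y y0 a) [^]\<^bsub>L\<^esub> Poly_Mapping.lookup A a) ?K = \<one>\<^bsub>L\<^esub>"
    using hB by simp
qed

theorem theorem1p2:
  fixes X :: "'a topology" and x0 :: 'a
    and Y :: "'b topology" and y0 :: 'b
    and Z :: "'c topology" and z0 :: 'c
    and L :: "('l, 'm) monoid_scheme"
    and q :: nat
    and b :: "'b \<Rightarrow> 'c"
    and h :: "('a \<Rightarrow> 'c) set \<Rightarrow> 'l"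
    and f :: "('a \<Rightarrow> 'b) set \<Rightarrow> 'l"
  assumes "cellular_space X x0" and "cellular_space Y y0" and "cellular_space Z z0"
    and "compact_space X" and "compact_space Y"
    and "q \<ge> 1"
    and "b \<in> based_maps Y y0 Z z0"
    and "strongly_similar Y y0 Z z0 (q - 1) b (const_map Y z0)"
    and "comm_group L"
    and "h \<in> homotopy_classes X x0 Z z0 \<rightarrow> carrier L"
    and "\<And>a. a \<in> based_maps X x0 Y y0 \<Longrightarrow>
           f (homotopy_class X x0 Y y0 a) =
           h (homotopy_class X x0 Z z0 (compose (topspace X) b a))"
  shows "enat q * invariant_order X x0 Y y0 L f \<le> invariant_order X x0 Z z0 L h"
proof (cases "\<exists>r. invariant_order_le X x0 Z z0 L h r")
  case False
  then show ?thesis by (simp add: invariant_order_def)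
next
  case True
  let ?n = "LEAST r. invariant_order_le X x0 Z z0 L h r"
  let ?le = "invariant_order_le X x0 Y y0 L f"
  obtain CX where CX: "CW_structure X CX" "{x0} \<in> CX 0"
    using assms(1) by (auto simp: cellular_space_def)
  obtain CY where CY: "CW_structure Y CY"
    using assms(2) by (auto simp: cellular_space_def)
  have x0: "x0 \<in> topspace X" using CW_cell_closure[OF CX] by auto
  obtain G where G: "diagonal_equalizer Y y0 G"
    using compact_cellular_diagonal_equalizer[OF assms(2,5)] by blast
  \<comment> \<open>The quotient \<open>?n div q\<close> bounds the order of \<open>f\<close>: it
    satisfies the strict inequality required of \<open>m\<close>, and multiplying it by
    \<open>q\<close> does not exceed \<open>?n\<close>, the order of \<open>h\<close>.\<close>
  have le: "?le (?n div q)"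
  proof (rule invariant_order_le_compose[OF assms(4) CW_structureD(1)[OF CX(1)] x0 assms(5)
        CW_structureD(1)[OF CY] G assms(6-10)])
    show "invariant_order_le X x0 Z z0 L h ?n" using True by (rule LeastI_ex)
    show "?n < q * (?n div q) + q" using assms(6) dividend_less_times_div[of q ?n] by simp
  qed (rule assms(11))
  then have "invariant_order X x0 Y y0 L f = enat (LEAST r. ?le r)"
    by (auto simp: invariant_order_def)
  moreover have "q * (LEAST r. ?le r) \<le> ?n"
    using mult_le_mono2[OF Least_le[of ?le, OF le], of q] times_div_less_eq_dividend[of q ?n]
    by (rule order_trans)
  ultimately show ?thesis using True by (simp add: invariant_order_def)
qed

end
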